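(* CMPV and RMPV admit problem kernels of size polynomial in $n+\tau$, where $n$ is the number of agents and $\tau$ the number of voting profiles.
   Context: An instance of CMPV or RMPV consists of a set of agents $A=\{a_1,\dots,a_n\}$, a set of candidates $C$, a sequence $U=(u_1,\dots,u_\tau)$ of voting profiles with $u_t\colon A\to C\cup\{\emptyset\}$, and integers $k\in\mathbb{N}$, $\ell\in\mathbb{N}_0$, $x\in\mathbb{N}$. For $C'\subseteq C$ let $\mathrm{score}_t(C')=|u_t^{-1}(C')|$. The question is whether there is a sequence $(C_1,\dots,C_\tau)$ of committees $C_t\subseteq C$ with $|C_t|\le k$ and $\mathrm{score}_t(C_t)\ge x$ for all $t$, and for all $t\in\{1,\dots,\tau-1\}$: $|C_t\triangle C_{t+1}|\le \ell$ (CMPV), respectively $|C_t\triangle C_{t+1}|\ge \ell$ (RMPV). A problem kernel for a parameter $p$ is a polynomial-time algorithm mapping each instance to an equivalent instance whose size is bounded by a function of $p$. *)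

theory Defs
  imports Complex_Main "HOL-Library.Log_Nat" "HOL-Computational_Algebra.Polynomial"
begin

section \<open>Multistage plurality voting\<close>

text \<open>
  A voting profile is a partial map from agents to candidates; the value \<open>None\<close> on an agent is the
  abstention, written as the empty set in the literature.
\<close>

record ('a, 'c) mpv =
  agents :: "'a set"
  candidates :: "'c set"
  profiles :: "('a \<Rightarrow> 'c option) list"
  com_size :: nat
  change :: nat
  min_score :: nat

text \<open>
  The condition \<open>dom u \<subseteq> agents I\<close> only fixes the irrelevant values of a profile outside the set of
  agents, so that a profile is the same thing as a function from the agents to the candidates plus
  one extra value. The positive integers are \<open>com_size\<close> and \<open>min_score\<close>; \<open>change\<close> may be zero.
\<close>

definition valid_mpv :: "('a, 'c) mpv \<Rightarrow> bool" where
  "valid_mpv I \<longleftrightarrow>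
     finite (agents I) \<and> finite (candidates I) \<and>
     (\<forall>u \<in> set (profiles I). dom u \<subseteq> agents I \<and> ran u \<subseteq> candidates I) \<and>
     com_size I \<ge> 1 \<and> min_score I \<ge> 1"

definition num_agents :: "('a, 'c) mpv \<Rightarrow> nat" where
  "num_agents I = card (agents I)"

definition num_profiles :: "('a, 'c) mpv \<Rightarrow> nat" where
  "num_profiles I = length (profiles I)"

definition score :: "('a \<Rightarrow> 'c option) \<Rightarrow> 'c set \<Rightarrow> nat" where
  "score u C' = card (u -` (Some ` C'))"

definition committees :: "('a, 'c) mpv \<Rightarrow> 'c set list \<Rightarrow> bool" where
  "committees I Cs \<longleftrightarrow>
     length Cs = num_profiles I \<and>
     (\<forall>t < num_profiles I.
        Cs ! t \<subseteq> candidates I \<and> card (Cs ! t) \<le> com_size I \<and>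
        score (profiles I ! t) (Cs ! t) \<ge> min_score I)"

definition CMPV :: "('a, 'c) mpv \<Rightarrow> bool" where
  "CMPV I \<longleftrightarrow>
     (\<exists>Cs. committees I Cs \<and>
        (\<forall>t. Suc t < num_profiles I \<longrightarrow> card (sym_diff (Cs ! t) (Cs ! Suc t)) \<le> change I))"

definition RMPV :: "('a, 'c) mpv \<Rightarrow> bool" where
  "RMPV I \<longleftrightarrow>
     (\<exists>Cs. committees I Cs \<and>
        (\<forall>t. Suc t < num_profiles I \<longrightarrow> card (sym_diff (Cs ! t) (Cs ! Suc t)) \<ge> change I))"


section \<open>Polynomial time: random access machines with logarithmic cost\<close>

definition nbits :: "nat \<Rightarrow> nat" where
  "nbits x = max 1 (floorlog 2 x)"

definition word_size :: "nat list \<Rightarrow> nat" where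
  "word_size xs = sum_list (map nbits xs)"

text \<open>
  A random access machine with a read-only input tape and a write-only output tape of natural
  numbers, in the style of Aho, Hopcroft and Ullman, but with structured control flow instead of
  jumps. A program mentions finitely many registers by name; the unbounded memory is accessed by
  computed addresses only. Subtraction is truncated at zero, and reading beyond the end of the
  input yields zero.
\<close>

datatype ram =
    Skip
  | Const nat nat
  | Add nat nat nat
  | Sub nat nat nat
  | Load nat nat
  | Store nat nat
  | Read nat
  | Write nat
  | Seq ram ram
  | IfNZ nat ram ram
  | WhileNZ nat ram

record ram_state =
  regs :: "nat \<Rightarrow> nat"
  mem :: "nat \<Rightarrow> nat"
  inp :: "nat list"
  outp :: "nat list"

definition init_state :: "nat list \<Rightarrow> ram_state" where
  "init_state xs = \<lparr>regs = (\<lambda>_. 0), mem = (\<lambda>_. 0), inp = xs, outp = []\<rparr>"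

definition next_input :: "ram_state \<Rightarrow> nat" where
  "next_input s = (case inp s of [] \<Rightarrow> 0 | x # _ \<Rightarrow> x)"

text \<open>
  \<open>exec P s t s'\<close>: started in \<open>s\<close>, the program \<open>P\<close> terminates in \<open>s'\<close> at total cost \<open>t\<close>. An
  elementary step costs the number of bits of all the numbers and addresses it handles.
\<close>

inductive exec :: "ram \<Rightarrow> ram_state \<Rightarrow> nat \<Rightarrow> ram_state \<Rightarrow> bool" where
  Skip: "exec Skip s 1 s"
| Const: "exec (Const r c) s (nbits c) (s\<lparr>regs := (regs s)(r := c)\<rparr>)"
| Add: "exec (Add r a b) s (nbits (regs s a) + nbits (regs s b))
          (s\<lparr>regs := (regs s)(r := regs s a + regs s b)\<rparr>)"
| Sub: "exec (Sub r a b) s (nbits (regs s a) + nbits (regs s b))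
          (s\<lparr>regs := (regs s)(r := regs s a - regs s b)\<rparr>)"
| Load: "exec (Load r a) s (nbits (regs s a) + nbits (mem s (regs s a)))
          (s\<lparr>regs := (regs s)(r := mem s (regs s a))\<rparr>)"
| Store: "exec (Store a r) s (nbits (regs s a) + nbits (regs s r))
          (s\<lparr>mem := (mem s)(regs s a := regs s r)\<rparr>)"
| Read: "exec (Read r) s (nbits (next_input s))
          (s\<lparr>regs := (regs s)(r := next_input s), inp := tl (inp s)\<rparr>)"
| Write: "exec (Write r) s (nbits (regs s r)) (s\<lparr>outp := outp s @ [regs s r]\<rparr>)"
| Seq: "exec P s t1 s1 \<Longrightarrow> exec Q s1 t2 s2 \<Longrightarrow> exec (Seq P Q) s (t1 + t2) s2"
| IfTrue: "regs s r \<noteq> 0 \<Longrightarrow> exec P s t s1 \<Longrightarrow> exec (IfNZ r P Q) s (nbits (regs s r) + t) s1"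
| IfFalse: "regs s r = 0 \<Longrightarrow> exec Q s t s1 \<Longrightarrow> exec (IfNZ r P Q) s (nbits (regs s r) + t) s1"
| WhileTrue: "regs s r \<noteq> 0 \<Longrightarrow> exec P s t1 s1 \<Longrightarrow> exec (WhileNZ r P) s1 t2 s2 \<Longrightarrow>
          exec (WhileNZ r P) s (nbits (regs s r) + t1 + t2) s2"
| WhileFalse: "regs s r = 0 \<Longrightarrow> exec (WhileNZ r P) s (nbits (regs s r)) s"

inductive_cases exec_elims:
  "exec Skip s t s'" "exec (Const r c) s t s'" "exec (Add r a b) s t s'" "exec (Sub r a b) s t s'"
  "exec (Load r a) s t s'" "exec (Store a r) s t s'" "exec (Read r) s t s'" "exec (Write r) s t s'"
  "exec (Seq P Q) s t s'" "exec (IfNZ r P Q) s t s'"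

inductive_cases exec_WhileE: "exec (WhileNZ r P) s t s'"

lemma exec_deterministic:
  "exec P s t s1 \<Longrightarrow> exec P s t' s2 \<Longrightarrow> t' = t \<and> s2 = s1"
proof (induction arbitrary: t' s2 rule: exec.induct)
  case (Seq P s t1 s1 Q t2 s2')
  from Seq.prems obtain u1 v u2 where "exec P s u1 v" "exec Q v u2 s2" "t' = u1 + u2"
    by (rule exec_elims(9)) blast
  then show ?case using Seq.IH(1)[of u1 v] Seq.IH(2)[of u2 s2] by simp
next
  case (IfTrue s r P t s1 Q)
  from IfTrue.prems IfTrue.hyps(1) obtain u where "exec P s u s2" "t' = nbits (regs s r) + u"
    by (auto elim: exec_elims(10))
  then show ?case using IfTrue.IH[of u s2] by simp
next
  case (IfFalse s r Q t s1 P)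
  from IfFalse.prems IfFalse.hyps(1) obtain u where "exec Q s u s2" "t' = nbits (regs s r) + u"
    by (auto elim: exec_elims(10))
  then show ?case using IfFalse.IH[of u s2] by simp
next
  case (WhileTrue s r P t1 s1 t2 s2')
  from WhileTrue.prems WhileTrue.hyps(1) obtain u1 v u2
    where "exec P s u1 v" "exec (WhileNZ r P) v u2 s2" "t' = nbits (regs s r) + u1 + u2"
    by (auto elim: exec_WhileE)
  then show ?case using WhileTrue.IH(1)[of u1 v] WhileTrue.IH(2)[of u2 s2] by simp
next
  case (WhileFalse s r P)
  from WhileFalse.prems show ?case
    by (cases rule: exec_WhileE) (use WhileFalse.hyps in auto)
qed (auto elim: exec_elims(1-8))


section \<open>Problem kernels\<close>

text \<open>
  A decision problem is given by its set \<open>valid\<close> of instances, its yes-instances \<open>yes\<close> (relevant on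
  \<open>valid\<close> only) and an encoding \<open>enc\<close> of the instances as words of natural numbers.
\<close>

definition poly_time_on :: "('i \<Rightarrow> bool) \<Rightarrow> ('i \<Rightarrow> nat list) \<Rightarrow> ('i \<Rightarrow> 'i) \<Rightarrow> bool" where
  "poly_time_on valid enc f \<longleftrightarrow>
     (\<exists>(P :: ram) (q :: nat poly). \<forall>I. valid I \<longrightarrow>
        (\<exists>t s. exec P (init_state (enc I)) t s \<and> outp s = enc (f I) \<and>
               t \<le> poly q (word_size (enc I))))"

definition problem_kernel ::
  "('i \<Rightarrow> bool) \<Rightarrow> ('i \<Rightarrow> bool) \<Rightarrow> ('i \<Rightarrow> nat list) \<Rightarrow> ('i \<Rightarrow> nat) \<Rightarrow> (nat \<Rightarrow> nat) \<Rightarrow> ('i \<Rightarrow> 'i) \<Rightarrow> bool"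
where
  "problem_kernel valid yes enc param g f \<longleftrightarrow>
     poly_time_on valid enc f \<and>
     (\<forall>I. valid I \<longrightarrow>
        valid (f I) \<and> (yes (f I) \<longleftrightarrow> yes I) \<and> word_size (enc (f I)) \<le> g (param I))"

definition admits_poly_kernel ::
  "('i \<Rightarrow> bool) \<Rightarrow> ('i \<Rightarrow> bool) \<Rightarrow> ('i \<Rightarrow> nat list) \<Rightarrow> ('i \<Rightarrow> nat) \<Rightarrow> bool"
where
  "admits_poly_kernel valid yes enc param \<longleftrightarrow>
     (\<exists>(p :: nat poly) f. problem_kernel valid yes enc param (poly p) f)"


section \<open>Encoding of instances\<close>

text \<open>
  For the purpose of computation, agents and candidates are named by arbitrary natural numbers. The
  agents and the candidates are listed explicitly, followed by the number of profiles, for each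
  profile the list of the votes of all agents in increasing order of their names, and the three
  numbers of the instance. Every list is preceded by its length; in particular, the size of an
  encoding is at least the number of agents, candidates and profiles.
\<close>

definition enc_vote :: "nat option \<Rightarrow> nat" where
  "enc_vote v = (case v of None \<Rightarrow> 0 | Some c \<Rightarrow> Suc c)"

definition enc_set :: "nat set \<Rightarrow> nat list" where
  "enc_set S = card S # sorted_list_of_set S"

definition enc_profile :: "nat set \<Rightarrow> (nat \<Rightarrow> nat option) \<Rightarrow> nat list" where
  "enc_profile A u = card A # map (\<lambda>a. enc_vote (u a)) (sorted_list_of_set A)"

definition enc_mpv :: "(nat, nat) mpv \<Rightarrow> nat list" where
  "enc_mpv I =
     enc_set (agents I) @ enc_set (candidates I) @
     [num_profiles I] @
     concat (map (enc_profile (agents I)) (profiles I)) @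
     [com_size I, change I, min_score I]"

lemma enc_vote_inj: "enc_vote v = enc_vote w \<Longrightarrow> v = w"
  by (auto simp: enc_vote_def split: option.splits)

lemma enc_set_append_inj:
  assumes "finite S" "finite T" "enc_set S @ xs = enc_set T @ ys"
  shows "S = T \<and> xs = ys"
proof -
  have "card S = card T" "sorted_list_of_set S @ xs = sorted_list_of_set T @ ys"
    using assms(3) by (auto simp: enc_set_def)
  then have "sorted_list_of_set S = sorted_list_of_set T \<and> xs = ys"
    by (metis append_eq_append_conv length_sorted_list_of_set)
  then show ?thesis
    using assms(1,2) by (metis set_sorted_list_of_set)
qed

lemma enc_profile_inj:
  assumes "finite A" "dom u \<subseteq> A" "dom v \<subseteq> A"
    and eq: "enc_profile A u = enc_profile A v"
  shows "u = v"
proof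
  fix a
  show "u a = v a"
  proof (cases "a \<in> A")
    case True
    then show ?thesis using eq assms(1) by (auto simp: enc_profile_def intro: enc_vote_inj)
  next
    case False
    then show ?thesis using assms(2,3) by (metis domIff subsetD)
  qed
qed

lemma enc_profiles_append_inj:
  assumes "finite A" "length us = length vs"
    and "\<forall>u \<in> set us. dom u \<subseteq> A" "\<forall>v \<in> set vs. dom v \<subseteq> A"
    and "concat (map (enc_profile A) us) @ xs =
         concat (map (enc_profile A) vs) @ ys"
  shows "us = vs \<and> xs = ys"
  using assms(2-)
proof (induction us vs rule: list_induct2)
  case Nil
  then show ?case by simp
next
  case (Cons u us v vs)
  let ?e = "enc_profile A"
  have "?e u @ (concat (map ?e us) @ xs) = ?e v @ (concat (map ?e vs) @ ys)"
    using Cons.prems(3) by (simp only: list.map concat.simps append_assoc)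
  then have "?e u = ?e v" and rest: "concat (map ?e us) @ xs = concat (map ?e vs) @ ys"
    using append_eq_append_conv[of "?e u" "?e v"] by (simp_all add: enc_profile_def)
  then have "u = v"
    using enc_profile_inj[OF assms(1), of u v] Cons.prems(1,2) by simp
  then show ?case
    using Cons.IH Cons.prems(1,2) rest by simp
qed

lemma enc_mpv_inj: "inj_on enc_mpv {I. valid_mpv I}"
proof (rule inj_onI)
  fix I J :: "(nat, nat) mpv"
  assume "I \<in> {I. valid_mpv I}" "J \<in> {I. valid_mpv I}" and eq: "enc_mpv I = enc_mpv J"
  then have I: "valid_mpv I" and J: "valid_mpv J" by auto
  have fin: "finite (agents I)" "finite (agents J)" "finite (candidates I)" "finite (candidates J)"
    using I J by (simp_all add: valid_mpv_def)
  note 1 = enc_set_append_inj[OF fin(1,2) eq[unfolded enc_mpv_def]]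
  note 2 = enc_set_append_inj[OF fin(3,4) conjunct2[OF 1]]
  have A: "agents I = agents J" and C: "candidates I = candidates J"
    using 1 2 by blast+
  have "profiles I = profiles J \<and>
      [com_size I, change I, min_score I] = [com_size J, change J, min_score J]"
    using conjunct2[OF 2] I J A
    by (intro enc_profiles_append_inj[OF fin(1)]) (simp_all add: valid_mpv_def num_profiles_def)
  then show "I = J" using A C by simp
qed

end

theory Submission
  imports Defs
begin

text \<open>
  Only the at most \<open>m \<le> n \<tau>\<close> candidates that receive a vote matter individually. For CMPV the other
  ones can be dropped, since intersecting all committees with the voted candidates changes no score
  and increases no symmetric difference.

  For RMPV the \<open>d\<close> candidates without votes are interchangeable, and only the number \<open>a\<^sub>t\<close> of them in
  the committee \<open>t\<close> matters: the best possible symmetric difference of the parts without votes of two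
  successive committees is \<open>min (s, 2 d - s) = d - \<bar>s - d\<bar>\<close> where \<open>s = a\<^sub>t + a\<^sub>t\<^sub>+\<^sub>1\<close>. Clamping all \<open>a\<^sub>t\<close> into
  an interval \<open>[r, d - r]\<close> does not increase \<open>\<bar>s - d\<bar>\<close>, and it is possible for \<open>r \<le> k - m\<close>. Then all
  \<open>a\<^sub>t\<close> can be lowered by \<open>r\<close>, so that \<open>(k, l, d)\<close> may be replaced by \<open>(k - r, l - 2 r, d - 2 r)\<close>. For the
  largest possible \<open>r\<close> one of the three numbers becomes small, and then the others can be truncated.

  The machine reads the votes once and numbers the voted candidates in the order of their first
  appearance, using the names of the candidates as addresses.
\<close>

section \<open>Step counting for random access machines\<close>

lemma nbits_le_iff: "1 \<le> B \<Longrightarrow> nbits x \<le> B \<longleftrightarrow> x < 2 ^ B"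
  by (simp add: nbits_def floorlog_le_iff)

definition fits :: "nat \<Rightarrow> ram_state \<Rightarrow> bool" where
  "fits B s \<longleftrightarrow> 1 \<le> B \<and> (\<forall>r. regs s r < 2 ^ B) \<and> (\<forall>a. mem s a < 2 ^ B) \<and>
     (\<forall>x \<in> set (inp s). x < 2 ^ B)"

lemma fits_mono: "fits B s \<Longrightarrow> B \<le> B' \<Longrightarrow> fits B' s"
  unfolding fits_def
  by (meson le_trans less_le_trans one_le_numeral power_increasing)

lemma fits_nbits:
  assumes "fits B s"
  shows "nbits (regs s r) \<le> B" "nbits (mem s a) \<le> B" "nbits (next_input s) \<le> B" "1 \<le> B"
    "next_input s < 2 ^ B"
  using assms
  by (auto simp: fits_def nbits_le_iff next_input_def split: list.splits)

fun const_bits :: "ram \<Rightarrow> nat" where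
  "const_bits (Const r c) = nbits c"
| "const_bits (Seq P Q) = max (const_bits P) (const_bits Q)"
| "const_bits (IfNZ r P Q) = max (const_bits P) (const_bits Q)"
| "const_bits (WhileNZ r P) = const_bits P"
| "const_bits _ = 1"

text \<open>
  The number \<open>c\<close> counts elementary steps at unit cost. As one step lengthens the numbers in a state
  by at most one bit, a bound on \<open>c\<close> also bounds the logarithmic cost \<open>t\<close>.
\<close>

definition triple ::
  "(ram_state \<Rightarrow> bool) \<Rightarrow> nat \<Rightarrow> ram \<Rightarrow> (ram_state \<Rightarrow> bool) \<Rightarrow> bool" where
  "triple Q c P R \<longleftrightarrow> (\<forall>s. Q s \<longrightarrow> (\<exists>t s'. exec P s t s' \<and> R s' \<and>
     (\<forall>B. const_bits P \<le> B \<longrightarrow> fits B s \<longrightarrow> t \<le> 2 * c * (B + c) \<and> fits (B + c) s')))"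

lemma triple_conseq:
  assumes "triple Q c P R" "\<And>s. Q' s \<Longrightarrow> Q s" "\<And>s. R s \<Longrightarrow> R' s" "c \<le> c'"
  shows "triple Q' c' P R'"
  unfolding triple_def
proof (intro allI impI)
  fix s assume "Q' s"
  then obtain t s' where *: "exec P s t s'" "R s'"
    "\<And>B. const_bits P \<le> B \<Longrightarrow> fits B s \<Longrightarrow> t \<le> 2 * c * (B + c) \<and> fits (B + c) s'"
    using assms(1,2) unfolding triple_def by metis
  have "t \<le> 2 * c' * (B + c') \<and> fits (B + c') s'" if "const_bits P \<le> B" "fits B s" for B
  proof -
    have "2 * c * (B + c) \<le> 2 * c' * (B + c')"
      using assms(4) by (intro mult_mono) auto
    then show ?thesis using *(3)[OF that] assms(4) fits_mono[of "B + c" s' "B + c'"] by auto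
  qed
  then show "\<exists>t s'. exec P s t s' \<and> R' s' \<and>
      (\<forall>B. const_bits P \<le> B \<longrightarrow> fits B s \<longrightarrow> t \<le> 2 * c' * (B + c') \<and> fits (B + c') s')"
    using *(1,2) assms(3) by blast
qed

lemma triple_Seq:
  assumes "triple Q c P R" "triple R d P' S"
  shows "triple Q (c + d) (Seq P P') S"
  unfolding triple_def
proof (intro allI impI)
  fix s assume "Q s"
  then obtain t s' where 1: "exec P s t s'" "R s'"
    "\<And>B. const_bits P \<le> B \<Longrightarrow> fits B s \<Longrightarrow> t \<le> 2 * c * (B + c) \<and> fits (B + c) s'"
    using assms(1) unfolding triple_def by metis
  then obtain t' s'' where 2: "exec P' s' t' s''" "S s''"
    "\<And>B. const_bits P' \<le> B \<Longrightarrow> fits B s' \<Longrightarrow> t' \<le> 2 * d * (B + d) \<and> fits (B + d) s''"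
    using assms(2) unfolding triple_def by metis
  have "t + t' \<le> 2 * (c + d) * (B + (c + d)) \<and> fits (B + (c + d)) s''"
    if B: "const_bits (Seq P P') \<le> B" "fits B s" for B
  proof -
    have "t \<le> 2 * c * (B + c)" "fits (B + c) s'" using 1(3)[of B] B by auto
    moreover have "t' \<le> 2 * d * (B + c + d)" "fits (B + c + d) s''"
      using 2(3)[of "B + c"] B calculation by auto
    moreover have "2 * c * (B + c) \<le> 2 * c * (B + (c + d))" by simp
    ultimately show ?thesis by (auto simp: algebra_simps)
  qed
  then show "\<exists>t s'. exec (Seq P P') s t s' \<and> S s' \<and>
      (\<forall>B. const_bits (Seq P P') \<le> B \<longrightarrow> fits B s \<longrightarrow>
        t \<le> 2 * (c + d) * (B + (c + d)) \<and> fits (B + (c + d)) s')"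
    using exec.Seq[OF 1(1) 2(1)] 2(2) by blast
qed

lemma triple_IfNZ:
  assumes "triple (\<lambda>s. Q s \<and> regs s r \<noteq> 0) c P R" "triple (\<lambda>s. Q s \<and> regs s r = 0) c P' R"
  shows "triple Q (Suc c) (IfNZ r P P') R"
  unfolding triple_def
proof (intro allI impI)
  fix s assume "Q s"
  then obtain t s' where 1: "exec (IfNZ r P P') s (nbits (regs s r) + t) s'" "R s'"
    "\<And>B. const_bits (IfNZ r P P') \<le> B \<Longrightarrow> fits B s \<Longrightarrow> t \<le> 2 * c * (B + c) \<and> fits (B + c) s'"
    using assms unfolding triple_def
    by (cases "regs s r = 0") (auto intro: exec.IfTrue exec.IfFalse, (metis exec.IfFalse exec.IfTrue)+)
  have "nbits (regs s r) + t \<le> 2 * Suc c * (B + Suc c) \<and> fits (B + Suc c) s'"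
    if B: "const_bits (IfNZ r P P') \<le> B" "fits B s" for B
    using 1(3)[OF B] fits_nbits(1)[OF B(2), of r] fits_mono[of "B + c" s' "B + Suc c"]
    by (auto simp: algebra_simps)
  then show "\<exists>t s'. exec (IfNZ r P P') s t s' \<and> R s' \<and>
      (\<forall>B. const_bits (IfNZ r P P') \<le> B \<longrightarrow> fits B s \<longrightarrow>
        t \<le> 2 * Suc c * (B + Suc c) \<and> fits (B + Suc c) s')"
    using 1(1,2) by blast
qed

lemma triple_WhileNZ_step:
  assumes "triple Q c P R" "triple R d (WhileNZ r P) S" "\<And>s. Q s \<Longrightarrow> regs s r \<noteq> 0"
  shows "triple Q (Suc c + d) (WhileNZ r P) S"
  unfolding triple_def
proof (intro allI impI)
  fix s assume "Q s"
  then obtain t s' where 1: "exec P s t s'" "R s'"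
    "\<And>B. const_bits P \<le> B \<Longrightarrow> fits B s \<Longrightarrow> t \<le> 2 * c * (B + c) \<and> fits (B + c) s'"
    using assms(1) unfolding triple_def by metis
  then obtain t' s'' where 2: "exec (WhileNZ r P) s' t' s''" "S s''"
    "\<And>B. const_bits P \<le> B \<Longrightarrow> fits B s' \<Longrightarrow> t' \<le> 2 * d * (B + d) \<and> fits (B + d) s''"
    using assms(2) unfolding triple_def const_bits.simps by metis
  have "nbits (regs s r) + t + t' \<le> 2 * (Suc c + d) * (B + (Suc c + d)) \<and>
      fits (B + (Suc c + d)) s''"
    if B: "const_bits P \<le> B" "fits B s" for B
  proof -
    have "t \<le> 2 * c * (B + c)" "fits (B + c) s'" using 1(3)[of B] B by auto
    moreover have "t' \<le> 2 * d * (B + c + d)" "fits (B + c + d) s''"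
      using 2(3)[of "B + c"] B calculation by auto
    moreover have "2 * c * (B + c) \<le> 2 * c * (B + (c + d))" by simp
    ultimately show ?thesis
      using fits_nbits(1)[OF B(2), of r] fits_mono[of "B + c + d" s'' "B + (Suc c + d)"]
      by (auto simp: algebra_simps)
  qed
  then show "\<exists>t s'. exec (WhileNZ r P) s t s' \<and> S s' \<and>
      (\<forall>B. const_bits (WhileNZ r P) \<le> B \<longrightarrow> fits B s \<longrightarrow>
        t \<le> 2 * (Suc c + d) * (B + (Suc c + d)) \<and> fits (B + (Suc c + d)) s')"
    using exec.WhileTrue[OF assms(3)[OF \<open>Q s\<close>] 1(1) 2(1)] 2(2) unfolding const_bits.simps by blast
qed

lemma triple_WhileNZ_stop:
  assumes "\<And>s. Q s \<Longrightarrow> regs s r = 0"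
  shows "triple Q 1 (WhileNZ r P) Q"
  unfolding triple_def
proof (intro allI impI)
  fix s assume "Q s"
  have "nbits (regs s r) \<le> 2 * 1 * (B + 1) \<and> fits (B + 1) s" if "fits B s" for B
    using fits_nbits(1)[OF that, of r] fits_mono[OF that, of "B + 1"] by simp
  then show "\<exists>t s'. exec (WhileNZ r P) s t s' \<and> Q s' \<and>
      (\<forall>B. const_bits (WhileNZ r P) \<le> B \<longrightarrow> fits B s \<longrightarrow>
        t \<le> 2 * 1 * (B + 1) \<and> fits (B + 1) s')"
    using exec.WhileFalse[OF assms[OF \<open>Q s\<close>]] \<open>Q s\<close> by blast
qed

lemma triple_WhileNZ_list:
  assumes "\<And>done x xs. triple (Inv done (x # xs)) c P (Inv (done @ [x]) xs)"
    and "\<And>done xs s. Inv done xs s \<Longrightarrow> regs s r = 0 \<longleftrightarrow> xs = []"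
  shows "triple (Inv done xs) (Suc c * length xs + 1) (WhileNZ r P) (Inv (done @ xs) [])"
proof (induction xs arbitrary: "done")
  case Nil
  show ?case using triple_WhileNZ_stop[of "Inv done []" r P] assms(2)[of "done" "[]"] by simp
next
  case (Cons x xs)
  show ?case
    by (rule triple_conseq[OF triple_WhileNZ_step[OF assms(1) Cons.IH]])
      (use assms(2)[of "done" "x # xs"] in auto)
qed

fun wp :: "ram \<Rightarrow> (ram_state \<Rightarrow> bool) \<Rightarrow> ram_state \<Rightarrow> bool" where
  "wp Skip R s \<longleftrightarrow> R s"
| "wp (Const r c) R s \<longleftrightarrow> R (s\<lparr>regs := (regs s)(r := c)\<rparr>)"
| "wp (Add r a b) R s \<longleftrightarrow> R (s\<lparr>regs := (regs s)(r := regs s a + regs s b)\<rparr>)"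
| "wp (Sub r a b) R s \<longleftrightarrow> R (s\<lparr>regs := (regs s)(r := regs s a - regs s b)\<rparr>)"
| "wp (Load r a) R s \<longleftrightarrow> R (s\<lparr>regs := (regs s)(r := mem s (regs s a))\<rparr>)"
| "wp (Store a r) R s \<longleftrightarrow> R (s\<lparr>mem := (mem s)(regs s a := regs s r)\<rparr>)"
| "wp (Read r) R s \<longleftrightarrow> R (s\<lparr>regs := (regs s)(r := next_input s), inp := tl (inp s)\<rparr>)"
| "wp (Write r) R s \<longleftrightarrow> R (s\<lparr>outp := outp s @ [regs s r]\<rparr>)"
| "wp (Seq P Q) R s \<longleftrightarrow> wp P (wp Q R) s"
| "wp (IfNZ r P Q) R s \<longleftrightarrow> (if regs s r \<noteq> 0 then wp P R s else wp Q R s)"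
| "wp (WhileNZ r P) R s \<longleftrightarrow> False"

fun len :: "ram \<Rightarrow> nat" where
  "len (Seq P Q) = len P + len Q"
| "len (IfNZ r P Q) = Suc (len P + len Q)"
| "len _ = 1"

lemma triple_basic:
  assumes "\<And>s. exec P s (t s) (g s)"
    and "\<And>B s. const_bits P \<le> B \<Longrightarrow> fits B s \<Longrightarrow> t s \<le> 2 * B \<and> fits (B + 1) (g s)"
  shows "triple (\<lambda>s. R (g s)) 1 P R"
  unfolding triple_def
proof (intro allI impI exI conjI)
  fix s B assume "const_bits P \<le> B" "fits B s"
  then show "t s \<le> 2 * 1 * (B + 1)" "fits (B + 1) (g s)" using assms(2)[of B s] by auto
qed (rule assms(1))

lemma fits_Suc: "fits B s \<Longrightarrow> fits (B + 1) s"
  by (simp add: fits_mono)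

lemma fits_regs: "fits B s \<Longrightarrow> v < 2 ^ B \<Longrightarrow> fits B (s\<lparr>regs := (regs s)(r := v)\<rparr>)"
  by (simp add: fits_def)

lemma triple_wp: "triple (wp P R) (len P) P R"
proof (induction P arbitrary: R)
  case (Seq P1 P2)
  show ?case
    by (rule triple_conseq[OF triple_Seq[OF Seq.IH(1) Seq.IH(2)]]) auto
next
  case (IfNZ r P1 P2)
  have "triple (\<lambda>s. wp (IfNZ r P1 P2) R s \<and> regs s r \<noteq> 0) (len P1 + len P2) P1 R"
    by (rule triple_conseq[OF IfNZ.IH(1)]) auto
  moreover have "triple (\<lambda>s. wp (IfNZ r P1 P2) R s \<and> regs s r = 0) (len P1 + len P2) P2 R"
    by (rule triple_conseq[OF IfNZ.IH(2)]) auto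
  ultimately show ?case using triple_IfNZ by fastforce
next
  case (WhileNZ r P)
  show ?case by (simp add: triple_def)
next
  case Skip
  show ?case
    unfolding wp.simps len.simps
    by (rule triple_basic[OF exec.Skip, where R = R])
      (auto dest: fits_Suc fits_nbits(4))
next
  case (Const r c)
  have "c < 2 ^ (B + 1)" if "nbits c \<le> B" for B
    using that nbits_le_iff[of "B + 1" c] by simp
  moreover have "nbits c \<le> 2 * B" if "nbits c \<le> B" for B
    using that by simp
  ultimately show ?case
    unfolding wp.simps len.simps
    by (intro triple_basic[OF exec.Const, where R = R] conjI fits_regs fits_Suc) auto
next
  case (Add r a b)
  have "regs s a + regs s b < 2 ^ (B + 1)" if "fits B s" for B s
    using that unfolding fits_def by (metis add_less_mono mult_2 power_add power_one_right mult.commute)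
  then show ?case
    unfolding wp.simps len.simps
    by (intro triple_basic[OF exec.Add, where R = R] conjI fits_regs fits_Suc)
      (auto simp: mult_2 intro!: add_mono fits_nbits(1))
next
  case (Sub r a b)
  have "regs s a - regs s b < 2 ^ (B + 1)" if "fits B s" for B s
    using fits_Suc[OF that] unfolding fits_def by (meson diff_le_self le_less_trans)
  then show ?case
    unfolding wp.simps len.simps
    by (intro triple_basic[OF exec.Sub, where R = R] conjI fits_regs fits_Suc)
      (auto simp: mult_2 intro!: add_mono fits_nbits(1))
next
  case (Load r a)
  have "mem s (regs s a) < 2 ^ (B + 1)" if "fits B s" for B s
    using fits_Suc[OF that] unfolding fits_def by simp
  then show ?case
    unfolding wp.simps len.simps
    by (intro triple_basic[OF exec.Load, where R = R] conjI fits_regs fits_Suc)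
      (auto simp: mult_2 intro!: add_mono fits_nbits(1,2))
next
  case (Store a r)
  have "fits (B + 1) (s\<lparr>mem := (mem s)(regs s a := regs s r)\<rparr>)" if "fits B s" for B s
    using fits_Suc[OF that] unfolding fits_def by simp
  then show ?case
    unfolding wp.simps len.simps
    by (intro triple_basic[OF exec.Store, where R = R] conjI)
      (auto simp: mult_2 intro!: add_mono fits_nbits(1))
next
  case (Read r)
  have "fits (B + 1) (s\<lparr>regs := (regs s)(r := next_input s), inp := tl (inp s)\<rparr>)"
    if "fits B s" for B s
    using fits_Suc[OF that] fits_nbits(5)[OF fits_Suc[OF that]]
    unfolding fits_def by (cases "inp s") auto
  moreover have "nbits (next_input s) \<le> 2 * B" if "fits B s" for B s
    using fits_nbits(3)[OF that] by simp
  ultimately show ?case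
    unfolding wp.simps len.simps
    by (intro triple_basic[OF exec.Read, where R = R] conjI)
next
  case (Write r)
  have "fits (B + 1) (s\<lparr>outp := outp s @ [regs s r]\<rparr>)" if "fits B s" for B s
    using fits_Suc[OF that] unfolding fits_def by simp
  moreover have "nbits (regs s r) \<le> 2 * B" if "fits B s" for B s
    using fits_nbits(1)[OF that, of r] by simp
  ultimately show ?case
    unfolding wp.simps len.simps
    by (intro triple_basic[OF exec.Write, where R = R] conjI)
qed

lemma triple_straight:
  assumes "\<And>s. Q s \<Longrightarrow> wp P R s" "len P \<le> c"
  shows "triple Q c P R"
  by (rule triple_conseq[OF triple_wp]) (use assms in auto)

section \<open>Reduction to the candidates with votes\<close>

lemma score_Int: "ran u \<subseteq> V \<Longrightarrow> score u (C \<inter> V) = score u C"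
proof -
  assume "ran u \<subseteq> V"
  then have "u -` Some ` (C \<inter> V) = u -` Some ` C" by (auto simp: ran_def)
  then show ?thesis by (simp add: score_def)
qed

lemma score_le: "finite A \<Longrightarrow> dom u \<subseteq> A \<Longrightarrow> score u C \<le> card A"
  unfolding score_def by (rule card_mono) auto

definition core ::
  "('a \<Rightarrow> 'c option) list \<Rightarrow> 'c set \<Rightarrow> nat \<Rightarrow> ((nat \<Rightarrow> nat) \<Rightarrow> (nat \<Rightarrow> nat) \<Rightarrow> bool) \<Rightarrow> bool" where
  "core us V x \<Phi> \<longleftrightarrow> (\<exists>Vs. (\<forall>t. Vs t \<subseteq> V) \<and> (\<forall>t < length us. x \<le> score (us ! t) (Vs t)) \<and>
     \<Phi> (\<lambda>t. card (Vs t)) (\<lambda>t. card (sym_diff (Vs t) (Vs (Suc t)))))"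

lemma core_cong:
  assumes "finite V"
    and "\<And>p q. (\<And>t. p t \<le> card V) \<Longrightarrow> (\<And>t. q t \<le> card V) \<Longrightarrow> \<Phi> p q = \<Psi> p q"
  shows "core us V x \<Phi> = core us V x \<Psi>"
proof -
  have "\<Phi> (\<lambda>t. card (Vs t)) (\<lambda>t. card (sym_diff (Vs t) (Vs (Suc t)))) =
      \<Psi> (\<lambda>t. card (Vs t)) (\<lambda>t. card (sym_diff (Vs t) (Vs (Suc t))))"
    if "\<forall>t. Vs t \<subseteq> V" for Vs
    by (rule assms(2); rule card_mono[OF assms(1)]) (use that in blast)+
  then show ?thesis unfolding core_def by (intro ex_cong1) auto
qed

lemma core_cap_score:
  assumes "finite A" "\<forall>u \<in> set us. dom u \<subseteq> A"
  shows "core us V (min x (Suc (card A))) \<Phi> = core us V x \<Phi>"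
proof -
  have "min x (Suc (card A)) \<le> score (us ! t) C \<longleftrightarrow> x \<le> score (us ! t) C"
    if "t < length us" for t C
    using score_le[OF assms(1), of "us ! t" C] assms(2) that by (auto simp: min_def)
  then show ?thesis unfolding core_def by (intro ex_cong1) auto
qed

lemma core_rename:
  assumes bij: "bij_betw \<rho> V W" and len: "length us' = length us"
    and sc: "\<And>t S. t < length us \<Longrightarrow> S \<subseteq> V \<Longrightarrow> score (us' ! t) (\<rho> ` S) = score (us ! t) S"
  shows "core us' W x \<Phi> = core us V x \<Phi>"
proof -
  have inj: "inj_on \<rho> V" and im: "\<rho> ` V = W" using bij by (auto simp: bij_betw_def)
  have card: "card (\<rho> ` S) = card S" if "S \<subseteq> V" for S
    using that inj by (meson card_image inj_on_subset)
  have sd: "card (sym_diff (\<rho> ` S) (\<rho> ` S')) = card (sym_diff S S')" if "S \<subseteq> V" "S' \<subseteq> V" for S S'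
  proof -
    have "sym_diff (\<rho> ` S) (\<rho> ` S') = \<rho> ` sym_diff S S'"
      using that inj by (auto simp: inj_on_def)
    then show ?thesis using card[of "sym_diff S S'"] that by auto
  qed
  show ?thesis
  proof
    assume "core us V x \<Phi>"
    then obtain Vs where Vs: "\<And>t. Vs t \<subseteq> V" "\<And>t. t < length us \<Longrightarrow> x \<le> score (us ! t) (Vs t)"
      "\<Phi> (\<lambda>t. card (Vs t)) (\<lambda>t. card (sym_diff (Vs t) (Vs (Suc t))))"
      unfolding core_def by blast
    then show "core us' W x \<Phi>"
      unfolding core_def
      by (intro exI[of _ "\<lambda>t. \<rho> ` Vs t"]) (use im in \<open>auto simp: len sc card sd\<close>)
  next
    assume "core us' W x \<Phi>"
    then obtain Ws where Ws: "\<And>t. Ws t \<subseteq> W" "\<And>t. t < length us \<Longrightarrow> x \<le> score (us' ! t) (Ws t)"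
      "\<Phi> (\<lambda>t. card (Ws t)) (\<lambda>t. card (sym_diff (Ws t) (Ws (Suc t))))"
      unfolding core_def len by blast
    have "\<forall>t. \<exists>S. S \<subseteq> V \<and> Ws t = \<rho> ` S"
      using Ws(1) im by (metis subset_image_iff)
    then obtain Vs where Vs: "\<And>t. Vs t \<subseteq> V" "\<And>t. Ws t = \<rho> ` Vs t"
      by metis
    have "\<Phi> (\<lambda>t. card (Vs t)) (\<lambda>t. card (sym_diff (Vs t) (Vs (Suc t))))"
      using Ws(3) by (simp only: Vs(2) card sd Vs(1))
    then show "core us V x \<Phi>"
      unfolding core_def using Ws(2) Vs by (intro exI[of _ Vs]) (auto simp: sc)
  qed
qed

definition calm :: "nat \<Rightarrow> nat \<Rightarrow> nat \<Rightarrow> (nat \<Rightarrow> nat) \<Rightarrow> (nat \<Rightarrow> nat) \<Rightarrow> bool" where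
  "calm \<tau> k l p q \<longleftrightarrow> (\<forall>t < \<tau>. p t \<le> k) \<and> (\<forall>t. Suc t < \<tau> \<longrightarrow> q t \<le> l)"

text \<open>
  The number \<open>a t\<close> is the number of members without votes in the committee \<open>t\<close>. Two subsets of
  sizes \<open>a\<close> and \<open>b\<close> of a set of size \<open>d\<close> have a symmetric difference of size at most
  \<open>min (a + b) (2 * d - (a + b))\<close>, and this bound is attained even if one of the subsets is given.
\<close>

definition lively :: "nat \<Rightarrow> nat \<Rightarrow> nat \<Rightarrow> nat \<Rightarrow> (nat \<Rightarrow> nat) \<Rightarrow> (nat \<Rightarrow> nat) \<Rightarrow> bool" where
  "lively \<tau> k l d p q \<longleftrightarrow> (\<exists>a. (\<forall>t. a t \<le> d) \<and> (\<forall>t < \<tau>. p t + a t \<le> k) \<and>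
     (\<forall>t. Suc t < \<tau> \<longrightarrow> l \<le> q t + min (a t + a (Suc t)) (2 * d - (a t + a (Suc t)))))"

lemma CMPV_core:
  assumes fin: "finite (candidates I)" and V: "V \<subseteq> candidates I"
    and ran: "\<forall>u \<in> set (profiles I). ran u \<subseteq> V"
  shows "CMPV I \<longleftrightarrow> core (profiles I) V (min_score I) (calm (num_profiles I) (com_size I) (change I))"
    (is "_ \<longleftrightarrow> ?core")
proof
  assume "CMPV I"
  then obtain Cs where Cs: "committees I Cs"
    "\<And>t. Suc t < num_profiles I \<Longrightarrow> card (sym_diff (Cs ! t) (Cs ! Suc t)) \<le> change I"
    unfolding CMPV_def by blast
  define Vs where "Vs t = (if t < num_profiles I then Cs ! t \<inter> V else {})" for t
  have sub: "Cs ! t \<subseteq> candidates I" if "t < num_profiles I" for t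
    using Cs(1) that by (simp add: committees_def)
  have "card (Vs t) \<le> com_size I" if "t < num_profiles I" for t
  proof -
    have "card (Vs t) \<le> card (Cs ! t)"
      using sub[OF that] fin by (auto simp: Vs_def intro!: card_mono intro: finite_subset)
    then show ?thesis using Cs(1) that by (auto simp: committees_def)
  qed
  moreover have "card (sym_diff (Vs t) (Vs (Suc t))) \<le> change I" if t: "Suc t < num_profiles I" for t
  proof -
    have "finite (sym_diff (Cs ! t) (Cs ! Suc t))"
      using sub[OF t] sub[of t] t fin by (auto intro: finite_subset)
    then have "card (sym_diff (Vs t) (Vs (Suc t))) \<le> card (sym_diff (Cs ! t) (Cs ! Suc t))"
      by (rule card_mono) (use t in \<open>auto simp: Vs_def\<close>)
    then show ?thesis using Cs(2)[OF t] by simp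
  qed
  moreover have "min_score I \<le> score (profiles I ! t) (Vs t)" if "t < num_profiles I" for t
    using Cs(1) that ran by (auto simp: committees_def Vs_def score_Int num_profiles_def)
  moreover have "Vs t \<subseteq> V" for t by (simp add: Vs_def)
  ultimately show ?core
    unfolding core_def calm_def num_profiles_def by (intro exI[of _ Vs]) auto
next
  assume ?core
  then obtain Vs where "\<And>t. Vs t \<subseteq> V"
    "\<And>t. t < num_profiles I \<Longrightarrow> min_score I \<le> score (profiles I ! t) (Vs t)"
    "calm (num_profiles I) (com_size I) (change I)
      (\<lambda>t. card (Vs t)) (\<lambda>t. card (sym_diff (Vs t) (Vs (Suc t))))"
    unfolding core_def num_profiles_def by blast
  then show "CMPV I"
    unfolding CMPV_def committees_def calm_def
    by (intro exI[of _ "map Vs [0..<num_profiles I]"]) (use V in \<open>auto dest: subsetD\<close>)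
qed

lemma card_sym_diff:
  assumes "finite A" "finite B"
  shows "card (sym_diff A B) = card (A \<union> B) - card (A \<inter> B)"
proof -
  have "sym_diff A B = (A \<union> B) - (A \<inter> B)" by blast
  then show ?thesis using assms by (metis card_Diff_subset finite_Int inf_le1 le_supI1)
qed

lemma card_sym_diff_le:
  assumes "finite E" "A \<subseteq> E" "B \<subseteq> E"
  shows "card (sym_diff A B) \<le> min (card A + card B) (2 * card E - (card A + card B))"
proof -
  have fin: "finite A" "finite B" using assms finite_subset by auto
  have "card (A \<union> B) \<le> card E" using assms by (auto intro: card_mono)
  then show ?thesis
    using card_sym_diff[OF fin] card_Un_Int[OF fin] by linarith
qed

lemma exists_max_sym_diff:
  assumes E: "finite E" and A: "A \<subseteq> E" and b: "b \<le> card E"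
  shows "\<exists>B \<subseteq> E. card B = b \<and>
    card (sym_diff A B) = min (card A + b) (2 * card E - (card A + b))"
proof -
  have fin: "finite A" using A E finite_subset by blast
  have le: "card A \<le> card E" using A E by (rule card_mono[rotated])
  have dif: "card (E - A) = card E - card A" using A fin by (simp add: card_Diff_subset)
  show ?thesis
  proof (cases "card A + b \<le> card E")
    case True
    then obtain B where B: "B \<subseteq> E - A" "card B = b"
      using dif by (metis obtain_subset_with_card_n add_le_imp_le_diff add.commute)
    have "finite B" using B E finite_subset by blast
    moreover have "A \<inter> B = {}" using B by blast
    ultimately have "card (sym_diff A B) = card A + b"
      using fin B by (simp add: card_sym_diff card_Un_disjoint)
    then show ?thesis using B True by (intro exI[of _ B]) auto
  next
    case False
    then obtain B where B: "E - A \<subseteq> B" "B \<subseteq> E" "card B = b"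
      using dif b by (metis E exists_subset_between Diff_subset le_diff_conv nat_le_linear add.commute)
    have finB: "finite B" using B E finite_subset by blast
    have "A \<union> B = E" using A B by blast
    then have "card (sym_diff A B) = 2 * card E - (card A + b)"
      using card_sym_diff[OF fin finB] card_Un_Int[OF fin finB] B by simp
    then show ?thesis using B False by (intro exI[of _ B]) auto
  qed
qed

lemma RMPV_core:
  assumes fin: "finite (candidates I)" and V: "V \<subseteq> candidates I"
    and ran: "\<forall>u \<in> set (profiles I). ran u \<subseteq> V"
  shows "RMPV I \<longleftrightarrow> core (profiles I) V (min_score I)
    (lively (num_profiles I) (com_size I) (change I) (card (candidates I - V)))"
    (is "_ \<longleftrightarrow> ?core")
proof
  assume "RMPV I"
  then obtain Cs where Cs: "committees I Cs"
    "\<And>t. Suc t < num_profiles I \<Longrightarrow> change I \<le> card (sym_diff (Cs ! t) (Cs ! Suc t))"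
    unfolding RMPV_def by blast
  define C where "C t = (if t < num_profiles I then Cs ! t else {})" for t
  have sub: "C t \<subseteq> candidates I" for t
    using Cs(1) by (simp add: committees_def C_def)
  have finC: "finite (C t)" for t using sub fin finite_subset by blast
  let ?a = "\<lambda>t. card (C t - V)"
  have "?a t \<le> card (candidates I - V)" for t
    by (rule card_mono) (use fin sub in auto)
  moreover have "card (C t \<inter> V) + ?a t \<le> com_size I" if "t < num_profiles I" for t
  proof -
    have "card (C t \<inter> V) + ?a t = card (C t)"
      using finC[of t] by (metis card_Int_Diff)
    then show ?thesis using Cs(1) that by (auto simp: committees_def C_def)
  qed
  moreover have "change I \<le> card (sym_diff (C t \<inter> V) (C (Suc t) \<inter> V)) +
      min (?a t + ?a (Suc t)) (2 * card (candidates I - V) - (?a t + ?a (Suc t)))"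
    if t: "Suc t < num_profiles I" for t
  proof -
    have "card (sym_diff (C t) (C (Suc t))) =
        card (sym_diff (C t) (C (Suc t)) \<inter> V) + card (sym_diff (C t) (C (Suc t)) - V)"
      using finC by (intro card_Int_Diff) auto
    moreover have "sym_diff (C t) (C (Suc t)) \<inter> V = sym_diff (C t \<inter> V) (C (Suc t) \<inter> V)"
      "sym_diff (C t) (C (Suc t)) - V = sym_diff (C t - V) (C (Suc t) - V)" by blast+
    ultimately have "change I \<le> card (sym_diff (C t \<inter> V) (C (Suc t) \<inter> V)) +
        card (sym_diff (C t - V) (C (Suc t) - V))"
      using Cs(2)[OF t] t by (simp add: C_def)
    moreover have "card (sym_diff (C t - V) (C (Suc t) - V)) \<le>
        min (?a t + ?a (Suc t)) (2 * card (candidates I - V) - (?a t + ?a (Suc t)))"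
      by (rule card_sym_diff_le) (use fin sub in auto)
    ultimately show ?thesis by (rule order_trans[OF _ add_left_mono])
  qed
  ultimately have "lively (num_profiles I) (com_size I) (change I) (card (candidates I - V))
      (\<lambda>t. card (C t \<inter> V)) (\<lambda>t. card (sym_diff (C t \<inter> V) (C (Suc t) \<inter> V)))"
    unfolding lively_def by (intro exI[of _ ?a]) auto
  moreover have "min_score I \<le> score (profiles I ! t) (C t \<inter> V)" if "t < num_profiles I" for t
    using Cs(1) that ran by (auto simp: committees_def C_def score_Int num_profiles_def)
  ultimately show ?core
    unfolding core_def num_profiles_def by (intro exI[of _ "\<lambda>t. C t \<inter> V"]) auto
next
  assume ?core
  then obtain Vs where Vs: "\<And>t. Vs t \<subseteq> V"
    "\<And>t. t < num_profiles I \<Longrightarrow> min_score I \<le> score (profiles I ! t) (Vs t)"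
    "lively (num_profiles I) (com_size I) (change I) (card (candidates I - V))
      (\<lambda>t. card (Vs t)) (\<lambda>t. card (sym_diff (Vs t) (Vs (Suc t))))"
    unfolding core_def num_profiles_def by blast
  let ?E = "candidates I - V"
  have finE: "finite ?E" using fin by simp
  obtain a where a: "\<And>t. a t \<le> card ?E" "\<And>t. t < num_profiles I \<Longrightarrow> card (Vs t) + a t \<le> com_size I"
    "\<And>t. Suc t < num_profiles I \<Longrightarrow> change I \<le> card (sym_diff (Vs t) (Vs (Suc t))) +
       min (a t + a (Suc t)) (2 * card ?E - (a t + a (Suc t)))"
    using Vs(3) unfolding lively_def by blast
  have "\<exists>D. \<forall>t. (D t \<subseteq> ?E \<and> card (D t) = a t) \<and>
      card (sym_diff (D t) (D (Suc t))) = min (a t + a (Suc t)) (2 * card ?E - (a t + a (Suc t)))"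
  proof (rule dependent_nat_choice)
    show "\<exists>A. A \<subseteq> ?E \<and> card A = a 0" using a(1) by (metis obtain_subset_with_card_n)
  next
    fix A t assume "A \<subseteq> ?E \<and> card A = a t"
    then show "\<exists>B. (B \<subseteq> ?E \<and> card B = a (Suc t)) \<and>
        card (sym_diff A B) = min (a t + a (Suc t)) (2 * card ?E - (a t + a (Suc t)))"
      using exists_max_sym_diff[OF finE, of A "a (Suc t)"] a(1) by auto
  qed
  then obtain D where D: "\<And>t. D t \<subseteq> ?E" "\<And>t. card (D t) = a t"
    "\<And>t. card (sym_diff (D t) (D (Suc t))) = min (a t + a (Suc t)) (2 * card ?E - (a t + a (Suc t)))"
    by blast
  have finV: "finite (Vs t)" for t using Vs(1) V fin by (meson finite_subset subset_trans)
  have finD: "finite (D t)" for t using D(1) finE by (meson finite_subset)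
  have "card (Vs t \<union> D t) = card (Vs t) + a t" for t
    using finV finD Vs(1)[of t] D(1)[of t] by (subst card_Un_disjoint) (auto simp: D(2))
  moreover have "change I \<le> card (sym_diff (Vs t \<union> D t) (Vs (Suc t) \<union> D (Suc t)))"
    if t: "Suc t < num_profiles I" for t
  proof -
    have "sym_diff (Vs t \<union> D t) (Vs (Suc t) \<union> D (Suc t)) =
        sym_diff (Vs t) (Vs (Suc t)) \<union> sym_diff (D t) (D (Suc t))"
      using Vs(1)[of t] Vs(1)[of "Suc t"] D(1)[of t] D(1)[of "Suc t"] by blast
    moreover have "card \<dots> = card (sym_diff (Vs t) (Vs (Suc t))) + card (sym_diff (D t) (D (Suc t)))"
      using Vs(1)[of t] Vs(1)[of "Suc t"] D(1)[of t] D(1)[of "Suc t"] finV finD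
      by (intro card_Un_disjoint) auto
    ultimately show ?thesis using a(3)[OF t] by (simp add: D(3))
  qed
  moreover have "score (profiles I ! t) (Vs t \<union> D t) = score (profiles I ! t) (Vs t)"
    if t: "t < num_profiles I" for t
  proof -
    have "(Vs t \<union> D t) \<inter> V = Vs t" using Vs(1)[of t] D(1)[of t] by blast
    then show ?thesis
      using score_Int[of "profiles I ! t" V "Vs t \<union> D t"] ran t by (simp add: num_profiles_def)
  qed
  moreover have "Vs t \<union> D t \<subseteq> candidates I" for t using Vs(1)[of t] D(1)[of t] V by blast
  ultimately show "RMPV I"
    unfolding RMPV_def committees_def
    by (intro exI[of _ "map (\<lambda>t. Vs t \<union> D t) [0..<num_profiles I]"]) (use a(2) Vs(2) in auto)
qed

lemma calm_cap:
  assumes "\<And>t. p t \<le> m" "\<And>t. q t \<le> m"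
  shows "calm \<tau> (min k (Suc m)) (min l m) p q = calm \<tau> k l p q"
proof -
  have "p t \<le> min k (Suc m) \<longleftrightarrow> p t \<le> k" "q t \<le> min l m \<longleftrightarrow> q t \<le> l" for t
    using assms[of t] by auto
  then show ?thesis by (simp add: calm_def)
qed

lemma clamp_sum:
  fixes a b d r :: nat
  assumes "a \<le> d" "b \<le> d" "2 * r \<le> d"
    and a': "a' = min (max a r) (d - r) - r" and b': "b' = min (max b r) (d - r) - r"
  shows "min (a + b) (2 * d - (a + b)) \<le> min (a' + b') (2 * (d - 2 * r) - (a' + b')) + 2 * r"
proof -
  obtain e where d: "d = 2 * r + e" using assms(3) le_Suc_ex by blast
  have cases: "(c \<le> r \<and> c' = 0) \<or> c = c' + r \<or> (r + e \<le> c \<and> c' = e)" "c' \<le> e"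
    if "c' = min (max c r) (d - r) - r" for c c'
    using that unfolding d by auto
  define M where "M = min (a + b) (2 * d - (a + b))"
  have M: "M \<le> a + b" "M + a + b \<le> 4 * r + 2 * e"
    using assms(1,2) unfolding M_def d by auto
  have "M \<le> a' + b' + 2 * r \<and> M + (a' + b') \<le> 2 * e + 2 * r"
    using cases(1)[OF a'] cases(1)[OF b'] cases(2)[OF a'] cases(2)[OF b'] M
    by (intro conjI) (elim disjE conjE; linarith)+
  moreover have "a' + b' \<le> 2 * e" using cases(2)[OF a'] cases(2)[OF b'] by linarith
  ultimately have "M \<le> min (a' + b') (2 * e - (a' + b')) + 2 * r" by linarith
  moreover have "d - 2 * r = e" using d by simp
  ultimately show ?thesis unfolding M_def by (simp only:)
qed

lemma lively_shift:
  assumes r: "r = 0 \<or> r + m \<le> k" "2 * r \<le> d" "2 * r \<le> l" and p: "\<And>t. p t \<le> m"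
  shows "lively \<tau> (k - r) (l - 2 * r) (d - 2 * r) p q = lively \<tau> k l d p q"
proof
  assume "lively \<tau> k l d p q"
  then obtain a where a: "\<And>t. a t \<le> d" "\<And>t. t < \<tau> \<Longrightarrow> p t + a t \<le> k"
    "\<And>t. Suc t < \<tau> \<Longrightarrow> l \<le> q t + min (a t + a (Suc t)) (2 * d - (a t + a (Suc t)))"
    unfolding lively_def by blast
  define b where "b t = min (max (a t) r) (d - r) - r" for t
  have "b t \<le> d - 2 * r" for t by (simp add: b_def)
  moreover have "p t + b t \<le> k - r" if "t < \<tau>" for t
    using a(2)[OF that] p[of t] r(1) by (auto simp: b_def min_def max_def)
  moreover have "l - 2 * r \<le> q t + min (b t + b (Suc t)) (2 * (d - 2 * r) - (b t + b (Suc t)))"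
    if "Suc t < \<tau>" for t
  proof -
    have "l - 2 * r \<le> q t + Y" if "l \<le> q t + X" "X \<le> Y + 2 * r" for X Y using that by simp
    then show ?thesis
      using a(3)[OF that] clamp_sum[OF a(1)[of t] a(1)[of "Suc t"] r(2) b_def b_def] by blast
  qed
  ultimately show "lively \<tau> (k - r) (l - 2 * r) (d - 2 * r) p q"
    unfolding lively_def by (intro exI[of _ b]) auto
next
  assume "lively \<tau> (k - r) (l - 2 * r) (d - 2 * r) p q"
  then obtain a where a: "\<And>t. a t \<le> d - 2 * r" "\<And>t. t < \<tau> \<Longrightarrow> p t + a t \<le> k - r"
    "\<And>t. Suc t < \<tau> \<Longrightarrow>
      l - 2 * r \<le> q t + min (a t + a (Suc t)) (2 * (d - 2 * r) - (a t + a (Suc t)))"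
    unfolding lively_def by blast
  have "a t + r \<le> d" for t using a(1)[of t] r(2) by linarith
  moreover have "p t + (a t + r) \<le> k" if "t < \<tau>" for t using a(2)[OF that] r(1) by linarith
  moreover have "l \<le> q t + min ((a t + r) + (a (Suc t) + r)) (2 * d - ((a t + r) + (a (Suc t) + r)))"
    if "Suc t < \<tau>" for t
    using a(3)[OF that] a(1)[of t] a(1)[of "Suc t"] r(2,3) by linarith
  ultimately show "lively \<tau> k l d p q"
    unfolding lively_def by (intro exI[of _ "\<lambda>t. a t + r"]) auto
qed

lemma lively_cap_change:
  assumes "k \<le> Suc m \<or> d \<le> 1 \<or> l \<le> 1" and q: "\<And>t. q t \<le> m"
  shows "lively \<tau> k (min l (3 * m + 3)) d p q = lively \<tau> k l d p q"
proof -
  have "min l (3 * m + 3) \<le> q t + min (a t + a (Suc t)) (2 * d - (a t + a (Suc t))) \<longleftrightarrow>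
      l \<le> q t + min (a t + a (Suc t)) (2 * d - (a t + a (Suc t)))"
    if "\<forall>t < \<tau>. p t + a t \<le> k" "Suc t < \<tau>" for a :: "nat \<Rightarrow> nat" and t
  proof -
    have "p t + a t \<le> k" "p (Suc t) + a (Suc t) \<le> k" using that by auto
    then show ?thesis using assms(1) q[of t] by linarith
  qed
  then show ?thesis unfolding lively_def by metis
qed

lemma lively_cap_dummies: "lively \<tau> k l (min d (2 * l)) p q = lively \<tau> k l d p q"
proof (cases "d \<le> 2 * l")
  case False
  show ?thesis
  proof
    assume "lively \<tau> k l d p q"
    then obtain a where a: "\<And>t. a t \<le> d" "\<And>t. t < \<tau> \<Longrightarrow> p t + a t \<le> k"
      "\<And>t. Suc t < \<tau> \<Longrightarrow> l \<le> q t + min (a t + a (Suc t)) (2 * d - (a t + a (Suc t)))"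
      unfolding lively_def by blast
    have "p t + min (a t) l \<le> k" if "t < \<tau>" for t using a(2)[OF that] by linarith
    moreover have "l \<le> q t + min (min (a t) l + min (a (Suc t)) l)
        (2 * min d (2 * l) - (min (a t) l + min (a (Suc t)) l))" if "Suc t < \<tau>" for t
      using a(3)[OF that] False by linarith
    moreover have "min (a t) l \<le> min d (2 * l)" for t using False by linarith
    ultimately show "lively \<tau> k l (min d (2 * l)) p q"
      unfolding lively_def by (intro exI[of _ "\<lambda>t. min (a t) l"]) auto
  next
    assume "lively \<tau> k l (min d (2 * l)) p q"
    then show "lively \<tau> k l d p q"
      unfolding lively_def by (elim exE) (rule_tac x = a in exI, fastforce)
  qed
qed (simp add: min_absorb1)

lemma lively_cap_size:
  assumes "\<And>t. p t \<le> m"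
  shows "lively \<tau> (min k (Suc (m + d))) l d p q = lively \<tau> k l d p q"
proof -
  have "p t + a t \<le> min k (Suc (m + d)) \<longleftrightarrow> p t + a t \<le> k" if "\<forall>t. a t \<le> d" for a :: "nat \<Rightarrow> nat" and t
    using assms[of t] that[rule_format, of t] by linarith
  then show ?thesis unfolding lively_def by (intro ex_cong1) auto
qed

definition slack :: "nat \<Rightarrow> nat \<Rightarrow> nat \<Rightarrow> nat \<Rightarrow> nat" where
  "slack m k l d = min (min (2 * (k - Suc m)) d) l div 2"

definition lively_change :: "nat \<Rightarrow> nat \<Rightarrow> nat \<Rightarrow> nat \<Rightarrow> nat" where
  "lively_change m k l d = min (l - 2 * slack m k l d) (3 * m + 3)"

definition lively_dummies :: "nat \<Rightarrow> nat \<Rightarrow> nat \<Rightarrow> nat \<Rightarrow> nat" where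
  "lively_dummies m k l d = min (d - 2 * slack m k l d) (2 * lively_change m k l d)"

definition lively_size :: "nat \<Rightarrow> nat \<Rightarrow> nat \<Rightarrow> nat \<Rightarrow> nat" where
  "lively_size m k l d = min (k - slack m k l d) (Suc (m + lively_dummies m k l d))"

lemma lively_reduce:
  assumes p: "\<And>t. p t \<le> m" and q: "\<And>t. q t \<le> m"
  shows "lively \<tau> (lively_size m k l d) (lively_change m k l d) (lively_dummies m k l d) p q =
    lively \<tau> k l d p q"
proof -
  let ?r = "slack m k l d"
  have r: "?r = 0 \<or> ?r + m \<le> k" "2 * ?r \<le> d" "2 * ?r \<le> l"
    by (auto simp: slack_def)
  have stop: "k - ?r \<le> Suc m \<or> d - 2 * ?r \<le> 1 \<or> l - 2 * ?r \<le> 1"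
    unfolding slack_def by linarith
  show ?thesis
    unfolding lively_size_def lively_cap_size[OF p]
    unfolding lively_dummies_def lively_cap_dummies
    unfolding lively_change_def lively_cap_change[OF stop q]
    using lively_shift[OF r p] .
qed

lemma lively_change_le: "lively_change m k l d \<le> 3 * m + 3"
  by (simp add: lively_change_def)

lemma lively_dummies_le: "lively_dummies m k l d \<le> 6 * m + 6" "lively_dummies m k l d \<le> d"
  using lively_change_le[of m k l d] unfolding lively_dummies_def by linarith+

lemma lively_size_le: "lively_size m k l d \<le> Suc (m + lively_dummies m k l d)"
  by (simp add: lively_size_def)

lemma lively_size_pos: "1 \<le> k \<Longrightarrow> 1 \<le> lively_size m k l d"
proof -
  assume "1 \<le> k"
  moreover have "slack m k l d \<le> k - Suc m" unfolding slack_def by linarith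
  ultimately show ?thesis unfolding lively_size_def by linarith
qed

section \<open>Renaming the agents and the candidates\<close>

fun scan_step :: "nat \<Rightarrow> (nat \<Rightarrow> nat) \<times> nat \<Rightarrow> (nat \<Rightarrow> nat) \<times> nat" where
  "scan_step v (T, m) = (if v = 0 \<or> T v \<noteq> 0 then (T, m) else (T(v := Suc m), Suc m))"

text \<open>
  The positive numbers in a list are numbered from \<open>1\<close> in the order of their first appearance;
  \<open>number vs v\<close> is \<open>0\<close> if \<open>v\<close> is zero or does not occur.
\<close>

definition number :: "nat list \<Rightarrow> nat \<Rightarrow> nat" where
  "number vs = fst (fold scan_step vs (\<lambda>_. 0, 0))"

definition distinct_count :: "nat list \<Rightarrow> nat" where
  "distinct_count vs = snd (fold scan_step vs (\<lambda>_. 0, 0))"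

lemma number_Nil [simp]: "number [] = (\<lambda>_. 0)"
  and distinct_count_Nil [simp]: "distinct_count [] = 0"
  by (simp_all add: number_def distinct_count_def)

lemma number_snoc:
  "number (vs @ [v]) =
    (if v = 0 \<or> number vs v \<noteq> 0 then number vs else (number vs)(v := Suc (distinct_count vs)))"
  by (cases "fold scan_step vs (\<lambda>_. 0, 0)") (simp add: number_def distinct_count_def)

lemma distinct_count_snoc:
  "distinct_count (vs @ [v]) =
    (if v = 0 \<or> number vs v \<noteq> 0 then distinct_count vs else Suc (distinct_count vs))"
  by (cases "fold scan_step vs (\<lambda>_. 0, 0)") (simp add: number_def distinct_count_def)

lemma number_eq_0_iff: "number vs v = 0 \<longleftrightarrow> v = 0 \<or> v \<notin> set vs"
  by (induction vs rule: rev_induct) (auto simp: number_snoc)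

lemma number_append: "v \<in> set vs \<Longrightarrow> number (vs @ ws) v = number vs v"
proof (induction ws rule: rev_induct)
  case (snoc w ws)
  show ?case
    using snoc number_eq_0_iff[of "vs @ ws" v] unfolding append_assoc[symmetric]
    by (auto simp: number_snoc simp del: append_assoc)
qed simp

lemma bij_betw_number: "bij_betw (number vs) (set vs - {0}) {1..distinct_count vs}"
proof (induction vs rule: rev_induct)
  case (snoc v vs)
  show ?case
  proof (cases "v = 0 \<or> v \<in> set vs")
    case True
    then have "number (vs @ [v]) = number vs" "distinct_count (vs @ [v]) = distinct_count vs"
      "set (vs @ [v]) - {0} = set vs - {0}"
      using number_eq_0_iff[of vs v] by (auto simp: number_snoc distinct_count_snoc)
    then show ?thesis using snoc by simp
  next
    case False
    let ?m = "distinct_count vs"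
    have eq: "number (vs @ [v]) = (number vs)(v := Suc ?m)" "distinct_count (vs @ [v]) = Suc ?m"
      using False number_eq_0_iff[of vs v] by (auto simp: number_snoc distinct_count_snoc)
    have "bij_betw ((number vs)(v := Suc ?m)) (set vs - {0}) {1..?m}"
      using snoc False by (subst bij_betw_cong[where g = "number vs"]) auto
    then have "bij_betw ((number vs)(v := Suc ?m)) ((set vs - {0}) \<union> {v}) ({1..?m} \<union> {Suc ?m})"
      by (intro bij_betw_combine) (auto simp: bij_betw_def)
    moreover have "(set vs - {0}) \<union> {v} = set (vs @ [v]) - {0}" "{1..?m} \<union> {Suc ?m} = {1..Suc ?m}"
      using False by auto
    ultimately show ?thesis unfolding eq by (simp only:)
  qed
qed (simp add: bij_betw_def)

definition dec_vote :: "nat \<Rightarrow> nat option" where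
  "dec_vote v = (case v of 0 \<Rightarrow> None | Suc c \<Rightarrow> Some c)"

lemma enc_dec_vote [simp]: "enc_vote (dec_vote v) = v"
  by (simp add: enc_vote_def dec_vote_def split: nat.split)

definition vote_codes :: "(nat, nat) mpv \<Rightarrow> (nat \<Rightarrow> nat option) \<Rightarrow> nat list" where
  "vote_codes I u = map (\<lambda>a. enc_vote (u a)) (sorted_list_of_set (agents I))"

definition vote_stream :: "(nat, nat) mpv \<Rightarrow> nat list" where
  "vote_stream I = concat (map (vote_codes I) (profiles I))"

definition num_voted :: "(nat, nat) mpv \<Rightarrow> nat" where
  "num_voted I = distinct_count (vote_stream I)"

definition voted :: "(nat, nat) mpv \<Rightarrow> nat set" where
  "voted I = (\<Union>u \<in> set (profiles I). ran u)"

definition renamed_profile :: "(nat, nat) mpv \<Rightarrow> (nat \<Rightarrow> nat option) \<Rightarrow> nat \<Rightarrow> nat option" where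
  "renamed_profile I u i =
    (if i < num_agents I then dec_vote (number (vote_stream I) (vote_codes I u ! i)) else None)"

definition reduced :: "(nat, nat) mpv \<Rightarrow> nat \<Rightarrow> nat \<Rightarrow> nat \<Rightarrow> (nat, nat) mpv" where
  "reduced I c k l = \<lparr>agents = {..<num_agents I}, candidates = {..<c},
     profiles = map (renamed_profile I) (profiles I),
     com_size = k, change = l, min_score = min (min_score I) (Suc (num_agents I))\<rparr>"

lemma length_vote_codes [simp]: "length (vote_codes I u) = num_agents I"
  by (simp add: vote_codes_def num_agents_def)

context
  fixes I :: "(nat, nat) mpv"
  assumes valid: "valid_mpv I"
begin

lemma finite_agents: "finite (agents I)" and finite_candidates: "finite (candidates I)"
  using valid by (auto simp: valid_mpv_def)

lemma dom_profile: "u \<in> set (profiles I) \<Longrightarrow> dom u \<subseteq> agents I"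
  and voted_subset: "voted I \<subseteq> candidates I"
  using valid by (auto simp: valid_mpv_def voted_def)

lemma set_vote_stream: "set (vote_stream I) - {0} = Suc ` voted I"
proof -
  have "c \<in> ran u \<longleftrightarrow> Suc c \<in> (\<lambda>a. enc_vote (u a)) ` agents I"
    if "u \<in> set (profiles I)" for c u
  proof
    assume "c \<in> ran u"
    then obtain a where "u a = Some c" by (auto simp: ran_def)
    then show "Suc c \<in> (\<lambda>a. enc_vote (u a)) ` agents I"
      using dom_profile[OF that] by (intro image_eqI[of _ _ a]) (auto simp: enc_vote_def)
  qed (auto simp: enc_vote_def ran_def split: option.splits)
  then have "v \<in> set (vote_stream I) - {0} \<longleftrightarrow> v \<in> Suc ` voted I" for v
    using finite_agents by (cases v) (auto simp: vote_stream_def vote_codes_def voted_def image_iff)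
  then show ?thesis by blast
qed

definition candidate_index :: "nat \<Rightarrow> nat" where
  "candidate_index c = number (vote_stream I) (Suc c) - 1"

lemma number_Suc:
  assumes "c \<in> voted I"
  shows "number (vote_stream I) (Suc c) = Suc (candidate_index c)"
proof -
  have "Suc c \<in> set (vote_stream I)" using assms set_vote_stream by blast
  then show ?thesis using number_eq_0_iff[of "vote_stream I" "Suc c"] by (simp add: candidate_index_def)
qed

lemma bij_betw_candidate_index: "bij_betw candidate_index (voted I) {..<num_voted I}"
proof -
  have "bij_betw (number (vote_stream I) \<circ> Suc) (voted I) {1..num_voted I}"
    using bij_betw_number[of "vote_stream I"] unfolding set_vote_stream num_voted_def
    by (intro bij_betw_trans[of Suc _ "Suc ` voted I"]) (auto intro: inj_on_imp_bij_betw)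
  moreover have "bij_betw (\<lambda>i. i - 1) {1..num_voted I} {..<num_voted I}"
    by (rule bij_betw_byWitness[where f' = Suc]) auto
  ultimately have "bij_betw ((\<lambda>i. i - 1) \<circ> (number (vote_stream I) \<circ> Suc)) (voted I) {..<num_voted I}"
    by (rule bij_betw_trans)
  then show ?thesis by (rule bij_betw_cong[THEN iffD1, rotated]) (simp add: candidate_index_def)
qed

lemma card_voted: "card (voted I) = num_voted I"
  using bij_betw_same_card[OF bij_betw_candidate_index] by simp

lemma finite_voted: "finite (voted I)"
  using voted_subset finite_candidates finite_subset by blast

lemma renamed_profile_eq:
  assumes u: "u \<in> set (profiles I)" and i: "i < num_agents I"
  shows "renamed_profile I u i = map_option candidate_index (u (sorted_list_of_set (agents I) ! i))"
proof -
  let ?v = "u (sorted_list_of_set (agents I) ! i)"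
  have code: "vote_codes I u ! i = enc_vote ?v"
    using i by (simp add: vote_codes_def num_agents_def)
  show ?thesis
  proof (cases ?v)
    case None
    then show ?thesis
      using i code number_eq_0_iff[of _ 0] by (simp add: renamed_profile_def enc_vote_def dec_vote_def)
  next
    case (Some c)
    then have "c \<in> voted I" using u by (auto simp: voted_def ran_def)
    then show ?thesis
      using i code Some number_Suc by (simp add: renamed_profile_def enc_vote_def dec_vote_def)
  qed
qed

lemma score_renamed:
  assumes u: "u \<in> set (profiles I)" and S: "S \<subseteq> voted I"
  shows "score (renamed_profile I u) (candidate_index ` S) = score u S"
proof -
  let ?as = "sorted_list_of_set (agents I)"
  let ?X = "renamed_profile I u -` Some ` candidate_index ` S"
  let ?Y = "u -` Some ` S"
  have inj: "inj_on candidate_index (voted I)"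
    using bij_betw_candidate_index by (simp add: bij_betw_def)
  have as: "bij_betw ((!) ?as) {..<num_agents I} (agents I)"
    using bij_betw_nth[of ?as "{..<num_agents I}" "agents I"] finite_agents
    by (simp add: num_agents_def)
  have X: "i \<in> ?X \<longleftrightarrow> i < num_agents I \<and> ?as ! i \<in> ?Y" for i
  proof (cases "i < num_agents I")
    case True
    have "c \<in> voted I" if "u (?as ! i) = Some c" for c
      using that u by (auto simp: voted_def ran_def)
    then show ?thesis
      using True S inj by (cases "u (?as ! i)") (auto simp: renamed_profile_eq[OF u True] inj_on_def)
  qed (auto simp: renamed_profile_def)
  have "(!) ?as ` ?X = ?Y"
  proof
    show "(!) ?as ` ?X \<subseteq> ?Y" using X by blast
  next
    have "?Y \<subseteq> (!) ?as ` {..<num_agents I}"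
      using dom_profile[OF u] as by (auto simp: bij_betw_def)
    then show "?Y \<subseteq> (!) ?as ` ?X" using X by blast
  qed
  moreover have "?X \<subseteq> {..<num_agents I}" using X by blast
  then have "inj_on ((!) ?as) ?X"
    using as unfolding bij_betw_def by (metis inj_on_subset)
  ultimately show ?thesis unfolding score_def by (metis card_image)
qed

lemma ran_renamed:
  assumes "u \<in> set (profiles I)"
  shows "ran (renamed_profile I u) \<subseteq> {..<num_voted I}"
proof
  fix c assume "c \<in> ran (renamed_profile I u)"
  then obtain i where i: "renamed_profile I u i = Some c" by (auto simp: ran_def)
  then have "i < num_agents I" by (auto simp: renamed_profile_def split: if_splits)
  then obtain c' where "u (sorted_list_of_set (agents I) ! i) = Some c'" "c = candidate_index c'"
    using i renamed_profile_eq[OF assms] by auto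
  moreover from this have "c' \<in> voted I" using assms by (auto simp: voted_def ran_def)
  ultimately show "c \<in> {..<num_voted I}"
    using bij_betw_candidate_index by (auto simp: bij_betw_def)
qed

lemma valid_reduced:
  assumes "num_voted I \<le> c" "1 \<le> k"
  shows "valid_mpv (reduced I c k l)"
proof -
  have "dom (renamed_profile I u) \<subseteq> {..<num_agents I}" for u
    by (auto simp: renamed_profile_def split: if_splits)
  moreover have "ran (renamed_profile I u) \<subseteq> {..<c}" if "u \<in> set (profiles I)" for u
    using ran_renamed[OF that] assms(1) by auto
  ultimately show ?thesis
    using assms(2) valid by (auto simp: valid_mpv_def reduced_def)
qed

lemma core_reduced:
  "core (map (renamed_profile I) (profiles I)) {..<num_voted I}
      (min (min_score I) (Suc (num_agents I))) \<Phi> =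
    core (profiles I) (voted I) (min_score I) \<Phi>"
proof -
  have "core (map (renamed_profile I) (profiles I)) {..<num_voted I}
      (min (min_score I) (Suc (num_agents I))) \<Phi> =
    core (profiles I) (voted I) (min (min_score I) (Suc (num_agents I))) \<Phi>"
    by (rule core_rename[OF bij_betw_candidate_index]) (auto intro: score_renamed)
  also have "\<dots> = core (profiles I) (voted I) (min_score I) \<Phi>"
    unfolding num_agents_def by (rule core_cap_score) (use finite_agents dom_profile in auto)
  finally show ?thesis .
qed

lemma CMPV_reduced:
  "CMPV (reduced I (num_voted I) (min (com_size I) (Suc (num_voted I))) (min (change I) (num_voted I)))
    \<longleftrightarrow> CMPV I" (is "CMPV ?J \<longleftrightarrow> _")
proof -
  let ?m = "num_voted I"
  have "CMPV ?J \<longleftrightarrow> core (profiles ?J) {..<?m} (min_score ?J)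
      (calm (num_profiles ?J) (com_size ?J) (change ?J))"
    by (rule CMPV_core) (use ran_renamed in \<open>auto simp: reduced_def\<close>)
  also have "\<dots> \<longleftrightarrow> core (profiles I) (voted I) (min_score I)
      (calm (num_profiles I) (min (com_size I) (Suc ?m)) (min (change I) ?m))"
    by (simp add: reduced_def num_profiles_def core_reduced)
  also have "\<dots> \<longleftrightarrow> core (profiles I) (voted I) (min_score I)
      (calm (num_profiles I) (com_size I) (change I))"
    using card_voted by (intro core_cong[OF finite_voted] calm_cap) auto
  also have "\<dots> \<longleftrightarrow> CMPV I"
    by (rule CMPV_core[symmetric]) (use voted_subset finite_candidates in \<open>auto simp: voted_def\<close>)
  finally show ?thesis .
qed

lemma RMPV_reduced:
  fixes m k l d :: nat
  defines "m \<equiv> num_voted I" and "k \<equiv> com_size I" and "l \<equiv> change I"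
    and "d \<equiv> card (candidates I) - num_voted I"
  shows "RMPV (reduced I (m + lively_dummies m k l d) (lively_size m k l d) (lively_change m k l d))
    \<longleftrightarrow> RMPV I" (is "RMPV ?J \<longleftrightarrow> _")
proof -
  have cand: "candidates ?J - {..<m} = {m..<m + lively_dummies m k l d}"
    by (auto simp: reduced_def)
  have d: "d = card (candidates I - voted I)"
    unfolding d_def using card_voted card_Diff_subset[OF finite_voted voted_subset] by simp
  have "RMPV ?J \<longleftrightarrow> core (profiles ?J) {..<m} (min_score ?J)
      (lively (num_profiles ?J) (com_size ?J) (change ?J) (card (candidates ?J - {..<m})))"
    by (rule RMPV_core) (use ran_renamed in \<open>auto simp: reduced_def m_def\<close>)
  also have "\<dots> \<longleftrightarrow> core (profiles I) (voted I) (min_score I)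
      (lively (num_profiles I) (lively_size m k l d) (lively_change m k l d) (lively_dummies m k l d))"
    unfolding cand by (simp add: reduced_def num_profiles_def core_reduced m_def)
  also have "\<dots> \<longleftrightarrow> core (profiles I) (voted I) (min_score I) (lively (num_profiles I) k l d)"
    using card_voted by (intro core_cong[OF finite_voted] lively_reduce) (auto simp: m_def)
  also have "\<dots> \<longleftrightarrow> RMPV I"
    unfolding d k_def l_def
    by (rule RMPV_core[symmetric]) (use voted_subset finite_candidates in \<open>auto simp: voted_def\<close>)
  finally show ?thesis .
qed

end

section \<open>The kernelization as a program\<close>

primrec seqs :: "ram list \<Rightarrow> ram" where
  "seqs [] = Skip"
| "seqs (P # Ps) = Seq P (seqs Ps)"

lemma next_input_Cons: "inp s = x # xs \<Longrightarrow> next_input s = x"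
  by (simp add: next_input_def)

text \<open>
  Register 0 holds the number 1 and register 9 the number 0. The registers 1, 2, 3 hold the numbers
  of agents, candidates and profiles, and register 4 the number of candidates with votes so far. The
  table of the new numbers of the candidates uses the even addresses, and the renamed votes are
  stored at the odd addresses, the next one at the address in register 5.
\<close>

definition skip_loop :: ram where
  "skip_loop = WhileNZ 6 (seqs [Read 7, Sub 6 6 0])"

definition scan_vote :: ram where
  "scan_vote = seqs
    [Read 7,
     IfNZ 7
       (seqs [Add 10 7 7, Load 11 10,
         IfNZ 11 Skip (seqs [Add 4 4 0, Add 11 4 9, Store 10 11])])
       (Const 11 0),
     Store 5 11, Add 5 5 0, Add 5 5 0, Sub 8 8 0]"

definition scan_profile :: ram where
  "scan_profile = Seq (seqs [Read 7, Add 8 1 9]) (Seq (WhileNZ 8 scan_vote) (Sub 6 6 0))"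

definition read_instance :: ram where
  "read_instance =
    Seq (seqs [Const 0 1, Read 1, Add 6 1 9]) (Seq skip_loop
    (Seq (seqs [Read 2, Add 6 2 9]) (Seq skip_loop
    (Seq (seqs [Read 3, Const 5 1, Add 6 3 9]) (Seq (WhileNZ 6 scan_profile)
    (seqs [Read 12, Read 13, Read 14, Const 5 1]))))))"

definition scanned :: "nat \<Rightarrow> nat \<Rightarrow> nat \<Rightarrow> nat list \<Rightarrow> ram_state \<Rightarrow> bool" where
  "scanned n c \<tau> vs s \<longleftrightarrow> regs s 0 = 1 \<and> regs s 9 = 0 \<and> regs s 1 = n \<and> regs s 2 = c \<and> regs s 3 = \<tau> \<and>
     regs s 4 = distinct_count vs \<and> regs s 5 = Suc (2 * length vs) \<and>
     (\<forall>v. mem s (2 * v) = number vs v) \<and>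
     (\<forall>i < length vs. mem s (Suc (2 * i)) = number vs (vs ! i)) \<and> outp s = []"

lemma number_snoc_same:
  "number (vs @ [v]) v = (if v = 0 then 0 else if number vs v \<noteq> 0 then number vs v else Suc (distinct_count vs))"
  using number_eq_0_iff[of vs 0] by (auto simp: number_snoc)

lemma triple_scan_vote:
  "triple (\<lambda>s. scanned n c \<tau> vs s \<and> inp s = v # xs \<and> regs s 8 = Suc j \<and> regs s 6 = i) 20 scan_vote
    (\<lambda>s. scanned n c \<tau> (vs @ [v]) s \<and> inp s = xs \<and> regs s 8 = j \<and> regs s 6 = i)"
proof (rule triple_straight)
  fix s assume s: "scanned n c \<tau> vs s \<and> inp s = v # xs \<and> regs s 8 = Suc j \<and> regs s 6 = i"
  have mem: "mem s (v + v) = number vs v"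
    using s unfolding scanned_def mult_2 by blast
  have old: "number (vs @ [v]) (vs ! i) = number vs (vs ! i)" if "i < length vs" for i
    using that by (simp add: number_append)
  have neq: "Suc (2 * a) \<noteq> v + v" "v + v \<noteq> Suc (2 * a)" "Suc (2 * a) \<noteq> 2 * b" "2 * b \<noteq> Suc (2 * a)"
    for a b by presburger+
  have zero: "number vs 0 = 0" by (simp add: number_eq_0_iff)
  have double: "2 * w = v + v \<longleftrightarrow> w = v" for w by auto
  show "wp scan_vote (\<lambda>s. scanned n c \<tau> (vs @ [v]) s \<and> inp s = xs \<and> regs s 8 = j \<and> regs s 6 = i) s"
    using s old
    by (auto simp: scan_vote_def scanned_def next_input_Cons mem neq double zero number_snoc_same
        number_snoc distinct_count_snoc nth_append less_Suc_eq)
qed (simp add: scan_vote_def)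

lemma triple_scan_profile:
  assumes "length ys = n"
  shows "triple (\<lambda>s. scanned n c \<tau> vs s \<and> inp s = n # ys @ xs \<and> regs s 6 = Suc i) (21 * n + 10)
    scan_profile (\<lambda>s. scanned n c \<tau> (vs @ ys) s \<and> inp s = xs \<and> regs s 6 = i)"
proof -
  define Inv where "Inv = (\<lambda>done zs s. scanned n c \<tau> (vs @ done) s \<and> inp s = zs @ xs \<and>
    regs s 8 = length zs \<and> regs s 6 = Suc i)"
  have "triple (Inv done (z # zs)) 20 scan_vote (Inv (done @ [z]) zs)" for "done" z zs
    unfolding Inv_def
    by (rule triple_conseq[OF triple_scan_vote[where vs = "vs @ done" and v = z and xs = "zs @ xs"
      and j = "length zs"]]) auto
  then have loop: "triple (Inv [] ys) (21 * n + 1) (WhileNZ 8 scan_vote) (Inv ys [])"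
    using triple_WhileNZ_list[of Inv 20 scan_vote 8 "[]" ys] assms by (auto simp: Inv_def)
  have start: "triple (\<lambda>s. scanned n c \<tau> vs s \<and> inp s = n # ys @ xs \<and> regs s 6 = Suc i) 3
      (seqs [Read 7, Add 8 1 9]) (Inv [] ys)"
    by (rule triple_straight) (auto simp: Inv_def scanned_def next_input_Cons assms)
  have stop: "triple (Inv ys []) 1 (Sub 6 6 0)
      (\<lambda>s. scanned n c \<tau> (vs @ ys) s \<and> inp s = xs \<and> regs s 6 = i)"
    by (rule triple_straight) (auto simp: Inv_def scanned_def)
  show ?thesis
    unfolding scan_profile_def
    by (rule triple_conseq[OF triple_Seq[OF start triple_Seq[OF loop stop]]]) auto
qed

lemma triple_scan_profiles:
  assumes "\<forall>b \<in> set bs. length b = n"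
  shows "triple (\<lambda>s. scanned n c \<tau> [] s \<and> inp s = concat (map ((#) n) bs) @ xs \<and> regs s 6 = length bs)
    ((21 * n + 11) * length bs + 1) (WhileNZ 6 scan_profile)
    (\<lambda>s. scanned n c \<tau> (concat bs) s \<and> inp s = xs)"
proof -
  define Inv where "Inv = (\<lambda>done zs s. scanned n c \<tau> (concat done) s \<and>
    inp s = concat (map ((#) n) zs) @ xs \<and> regs s 6 = length zs \<and> (\<forall>b \<in> set zs. length b = n))"
  have "triple (Inv done (z # zs)) (21 * n + 10) scan_profile (Inv (done @ [z]) zs)" for "done" z zs
  proof (cases "length z = n \<and> (\<forall>b \<in> set zs. length b = n)")
    case True
    then show ?thesis
      unfolding Inv_def
      by (intro triple_conseq[OF triple_scan_profile[where ys = z and vs = "concat done"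
        and xs = "concat (map ((#) n) zs) @ xs" and i = "length zs" and n = n]]) auto
  next
    case False
    then show ?thesis by (auto simp: triple_def Inv_def)
  qed
  then have "triple (Inv [] bs) ((21 * n + 11) * length bs + 1) (WhileNZ 6 scan_profile) (Inv bs [])"
    using triple_WhileNZ_list[of Inv "21 * n + 10" scan_profile 6 "[]" bs]
    by (auto simp: Inv_def add.commute)
  then show ?thesis
    by (rule triple_conseq) (use assms in \<open>auto simp: Inv_def\<close>)
qed

lemma triple_skip_loop:
  "triple (\<lambda>s. inp s = ys @ xs \<and> regs s 6 = length ys \<and> regs s 0 = 1 \<and> regs s 9 = 0 \<and> regs s 1 = n \<and>
      regs s 2 = c \<and> regs s 4 = 0 \<and> mem s = (\<lambda>_. 0) \<and> outp s = [])
    (4 * length ys + 1) skip_loop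
    (\<lambda>s. inp s = xs \<and> regs s 0 = 1 \<and> regs s 9 = 0 \<and> regs s 1 = n \<and>
      regs s 2 = c \<and> regs s 4 = 0 \<and> mem s = (\<lambda>_. 0) \<and> outp s = [])"
proof -
  define Inv where "Inv = (\<lambda>(done :: nat list) zs (s :: ram_state). inp s = zs @ xs \<and> regs s 6 = length zs \<and>
    regs s 0 = 1 \<and> regs s 9 = 0 \<and> regs s 1 = n \<and> regs s 2 = c \<and> regs s 4 = 0 \<and>
    mem s = (\<lambda>_. 0) \<and> outp s = [])"
  have "triple (Inv done (z # zs)) 3 (seqs [Read 7, Sub 6 6 0]) (Inv (done @ [z]) zs)" for "done" z zs
    by (rule triple_straight) (auto simp: Inv_def)
  then have "triple (Inv [] ys) (4 * length ys + 1) skip_loop (Inv ys [])"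
    using triple_WhileNZ_list[of Inv 3 "seqs [Read 7, Sub 6 6 0]" 6 "[]" ys]
    unfolding skip_loop_def by (auto simp: Inv_def)
  then show ?thesis
    by (rule triple_conseq) (auto simp: Inv_def)
qed

definition stored :: "nat list \<Rightarrow> nat \<Rightarrow> (nat \<Rightarrow> nat) \<Rightarrow> bool" where
  "stored ws a M \<longleftrightarrow> (\<exists>p. a = Suc (2 * p) \<and> (\<forall>j < length ws. M (Suc (2 * (p + j))) = ws ! j))"

lemma stored_ConsD:
  assumes "stored (w # ws) a M"
  shows "M a = w" "stored ws (Suc (Suc a)) M"
proof -
  obtain p where p: "a = Suc (2 * p)" "\<And>j. j < Suc (length ws) \<Longrightarrow> M (Suc (2 * (p + j))) = (w # ws) ! j"
    using assms unfolding stored_def by auto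
  show "M a = w" using p(2)[of 0] p(1) by simp
  show "stored ws (Suc (Suc a)) M"
    unfolding stored_def using p(1) p(2)[of "Suc _"] by (intro exI[of _ "Suc p"]) auto
qed

definition before :: "nat list \<Rightarrow> nat \<Rightarrow> nat \<Rightarrow> nat \<Rightarrow> nat \<Rightarrow> nat \<Rightarrow> nat \<Rightarrow> nat \<Rightarrow> ram_state \<Rightarrow> bool" where
  "before ws n c \<tau> m k l x s \<longleftrightarrow> regs s 0 = 1 \<and> regs s 9 = 0 \<and> regs s 1 = n \<and> regs s 2 = c \<and>
     regs s 3 = \<tau> \<and> regs s 4 = m \<and> regs s 12 = k \<and> regs s 13 = l \<and> regs s 14 = x \<and>
     stored ws (regs s 5) (mem s) \<and> outp s = []"

lemma triple_read_instance:
  assumes "length ys = n" "length cs = c" "length bs = \<tau>" "\<forall>b \<in> set bs. length b = n"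
  shows "triple (\<lambda>s. s = init_state (n # ys @ c # cs @ \<tau> # concat (map ((#) n) bs) @ [k, l, x]))
    ((21 * n + 11) * \<tau> + 4 * n + 4 * c + 30) read_instance
    (before (map (number (concat bs)) (concat bs)) n c \<tau> (distinct_count (concat bs)) k l x)"
proof -
  let ?bs = "concat (map ((#) n) bs) @ [k, l, x]"
  define Q where "Q = (\<lambda>c (s :: ram_state). regs s 0 = 1 \<and> regs s 9 = 0 \<and> regs s 1 = n \<and> regs s 2 = c \<and>
    regs s 4 = 0 \<and> mem s = (\<lambda>_. 0) \<and> outp s = [])"
  have 1: "triple (\<lambda>s. s = init_state (n # ys @ c # cs @ \<tau> # ?bs)) 4 (seqs [Const 0 1, Read 1, Add 6 1 9])
      (\<lambda>s. inp s = ys @ c # cs @ \<tau> # ?bs \<and> regs s 6 = length ys \<and> Q 0 s)"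
    by (rule triple_straight) (auto simp: init_state_def next_input_def Q_def assms)
  have 2: "triple (\<lambda>s. inp s = ys @ c # cs @ \<tau> # ?bs \<and> regs s 6 = length ys \<and> Q 0 s)
      (4 * length ys + 1) skip_loop (\<lambda>s. inp s = c # cs @ \<tau> # ?bs \<and> Q 0 s)"
    unfolding Q_def by (rule triple_skip_loop)
  have 3: "triple (\<lambda>s. inp s = c # cs @ \<tau> # ?bs \<and> Q 0 s) 3 (seqs [Read 2, Add 6 2 9])
      (\<lambda>s. inp s = cs @ \<tau> # ?bs \<and> regs s 6 = length cs \<and> Q c s)"
    by (rule triple_straight) (auto simp: next_input_def Q_def assms)
  have 4: "triple (\<lambda>s. inp s = cs @ \<tau> # ?bs \<and> regs s 6 = length cs \<and> Q c s)
      (4 * length cs + 1) skip_loop (\<lambda>s. inp s = \<tau> # ?bs \<and> Q c s)"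
    unfolding Q_def by (rule triple_skip_loop)
  have 5: "triple (\<lambda>s. inp s = \<tau> # ?bs \<and> Q c s) 4 (seqs [Read 3, Const 5 1, Add 6 3 9])
      (\<lambda>s. scanned n c \<tau> [] s \<and> inp s = ?bs \<and> regs s 6 = length bs)"
    by (rule triple_straight) (auto simp: next_input_def Q_def scanned_def assms)
  note 6 = triple_scan_profiles[OF assms(4), of c \<tau> "[k, l, x]"]
  have 7: "triple (\<lambda>s. scanned n c \<tau> (concat bs) s \<and> inp s = [k, l, x]) 5
      (seqs [Read 12, Read 13, Read 14, Const 5 1])
      (before (map (number (concat bs)) (concat bs)) n c \<tau> (distinct_count (concat bs)) k l x)"
    by (rule triple_straight)
      (auto simp: next_input_def scanned_def before_def stored_def intro!: exI[of _ 0])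
  show ?thesis
    unfolding read_instance_def
    by (rule triple_conseq[OF triple_Seq[OF 1 triple_Seq[OF 2 triple_Seq[OF 3 triple_Seq[OF 4
      triple_Seq[OF 5 triple_Seq[OF 6 7]]]]]]]) (auto simp: assms)
qed

definition count_loop :: ram where
  "count_loop = WhileNZ 6 (seqs [Write 7, Add 7 7 0, Sub 6 6 0])"

definition write_profile :: ram where
  "write_profile = Seq (seqs [Write 1, Add 8 1 9])
    (Seq (WhileNZ 8 (seqs [Load 11 5, Write 11, Add 5 5 0, Add 5 5 0, Sub 8 8 0])) (Sub 6 6 0))"

definition write_instance :: ram where
  "write_instance =
    Seq (seqs [Write 1, Const 7 0, Add 6 1 9]) (Seq count_loop
    (Seq (seqs [Write 15, Const 7 0, Add 6 15 9]) (Seq count_loop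
    (Seq (seqs [Write 3, Add 6 3 9]) (Seq (WhileNZ 6 write_profile)
    (seqs [Write 12, Write 13, Write 14]))))))"

definition ready :: "nat list \<Rightarrow> nat \<Rightarrow> nat \<Rightarrow> nat \<Rightarrow> nat \<Rightarrow> nat \<Rightarrow> nat \<Rightarrow> ram_state \<Rightarrow> bool" where
  "ready ws n c \<tau> k l x s \<longleftrightarrow> regs s 0 = 1 \<and> regs s 9 = 0 \<and> regs s 1 = n \<and> regs s 15 = c \<and>
     regs s 3 = \<tau> \<and> regs s 12 = k \<and> regs s 13 = l \<and> regs s 14 = x \<and> stored ws (regs s 5) (mem s)"

lemma triple_count_loop:
  "triple (\<lambda>s. ready ws n c \<tau> k l x s \<and> outp s = ys \<and> regs s 7 = 0 \<and> regs s 6 = N) (5 * N + 1)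
    count_loop (\<lambda>s. ready ws n c \<tau> k l x s \<and> outp s = ys @ [0..<N])"
proof -
  define Inv where "Inv = (\<lambda>done zs s. ready ws n c \<tau> k l x s \<and> outp s = ys @ done \<and>
    regs s 7 = length done \<and> regs s 6 = length zs \<and> done @ zs = [0..<N])"
  have "triple (Inv done (z # zs)) 4 (seqs [Write 7, Add 7 7 0, Sub 6 6 0]) (Inv (done @ [z]) zs)"
    for "done" z zs
  proof (cases "done @ z # zs = [0..<N]")
    case True
    then have "length done < N" "[0..<N] ! length done = z"
      by (metis length_append length_Cons length_upt diff_zero less_add_Suc1 add_Suc_right, metis nth_append_length)
    then have "z = length done" by simp
    then show ?thesis
      using True by (intro triple_straight) (auto simp: Inv_def ready_def)
  next
    case False
    then show ?thesis by (auto simp: triple_def Inv_def)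
  qed
  then have "triple (Inv [] [0..<N]) (5 * N + 1) count_loop (Inv [0..<N] [])"
    using triple_WhileNZ_list[of Inv 4 "seqs [Write 7, Add 7 7 0, Sub 6 6 0]" 6 "[]" "[0..<N]"]
    unfolding count_loop_def by (auto simp: Inv_def)
  then show ?thesis
    by (rule triple_conseq) (auto simp: Inv_def)
qed

lemma triple_write_profile:
  assumes "length ys = n"
  shows "triple (\<lambda>s. ready (ys @ ws) n c \<tau> k l x s \<and> outp s = xs \<and> regs s 6 = Suc i) (7 * n + 10)
    write_profile (\<lambda>s. ready ws n c \<tau> k l x s \<and> outp s = xs @ n # ys \<and> regs s 6 = i)"
proof -
  define Inv where "Inv = (\<lambda>done zs s. ready (zs @ ws) n c \<tau> k l x s \<and> outp s = xs @ n # done \<and>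
    regs s 8 = length zs \<and> regs s 6 = Suc i)"
  let ?P = "seqs [Load 11 5, Write 11, Add 5 5 0, Add 5 5 0, Sub 8 8 0]"
  have "triple (Inv done (z # zs)) 6 ?P (Inv (done @ [z]) zs)" for "done" z zs
    by (rule triple_straight) (auto simp: Inv_def ready_def dest: stored_ConsD)
  then have loop: "triple (Inv [] ys) (7 * n + 1) (WhileNZ 8 ?P) (Inv ys [])"
    using triple_WhileNZ_list[of Inv 6 ?P 8 "[]" ys] assms by (auto simp: Inv_def)
  have start: "triple (\<lambda>s. ready (ys @ ws) n c \<tau> k l x s \<and> outp s = xs \<and> regs s 6 = Suc i) 3
      (seqs [Write 1, Add 8 1 9]) (Inv [] ys)"
    by (rule triple_straight) (auto simp: Inv_def ready_def assms)
  have stop: "triple (Inv ys []) 1 (Sub 6 6 0)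
      (\<lambda>s. ready ws n c \<tau> k l x s \<and> outp s = xs @ n # ys \<and> regs s 6 = i)"
    by (rule triple_straight) (auto simp: Inv_def ready_def)
  show ?thesis
    unfolding write_profile_def
    by (rule triple_conseq[OF triple_Seq[OF start triple_Seq[OF loop stop]]]) auto
qed

lemma triple_write_profiles:
  assumes "\<forall>b \<in> set bs. length b = n"
  shows "triple (\<lambda>s. ready (concat bs) n c \<tau> k l x s \<and> outp s = xs \<and> regs s 6 = length bs)
    ((7 * n + 11) * length bs + 1) (WhileNZ 6 write_profile)
    (\<lambda>s. ready [] n c \<tau> k l x s \<and> outp s = xs @ concat (map ((#) n) bs))"
proof -
  define Inv where "Inv = (\<lambda>done zs s. ready (concat zs) n c \<tau> k l x s \<and>
    outp s = xs @ concat (map ((#) n) done) \<and> regs s 6 = length zs \<and> (\<forall>b \<in> set zs. length b = n))"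
  have "triple (Inv done (z # zs)) (7 * n + 10) write_profile (Inv (done @ [z]) zs)" for "done" z zs
  proof (cases "length z = n \<and> (\<forall>b \<in> set zs. length b = n)")
    case True
    then show ?thesis
      unfolding Inv_def
      by (intro triple_conseq[OF triple_write_profile[where ys = z and ws = "concat zs"
        and xs = "xs @ concat (map ((#) n) done)" and i = "length zs" and n = n]]) auto
  next
    case False
    then show ?thesis by (auto simp: triple_def Inv_def)
  qed
  then have "triple (Inv [] bs) ((7 * n + 11) * length bs + 1) (WhileNZ 6 write_profile) (Inv bs [])"
    using triple_WhileNZ_list[of Inv "7 * n + 10" write_profile 6 "[]" bs]
    by (auto simp: Inv_def add.commute)
  then show ?thesis
    by (rule triple_conseq) (use assms in \<open>auto simp: Inv_def\<close>)
qed

lemma triple_write_instance: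
  assumes "\<forall>b \<in> set bs. length b = n" "length bs = \<tau>"
  shows "triple (\<lambda>s. ready (concat bs) n c \<tau> k l x s \<and> outp s = [])
    ((7 * n + 11) * \<tau> + 5 * n + 5 * c + 30) write_instance
    (\<lambda>s. outp s = n # [0..<n] @ c # [0..<c] @ \<tau> # concat (map ((#) n) bs) @ [k, l, x])"
proof -
  let ?R = "ready (concat bs) n c \<tau> k l x"
  have 1: "triple (\<lambda>s. ?R s \<and> outp s = []) 4 (seqs [Write 1, Const 7 0, Add 6 1 9])
      (\<lambda>s. ?R s \<and> outp s = [n] \<and> regs s 7 = 0 \<and> regs s 6 = n)"
    by (rule triple_straight) (auto simp: ready_def)
  note 2 = triple_count_loop[of "concat bs" n c \<tau> k l x "[n]" n]
  have 3: "triple (\<lambda>s. ?R s \<and> outp s = [n] @ [0..<n]) 4 (seqs [Write 15, Const 7 0, Add 6 15 9])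
      (\<lambda>s. ?R s \<and> outp s = n # [0..<n] @ [c] \<and> regs s 7 = 0 \<and> regs s 6 = c)"
    by (rule triple_straight) (auto simp: ready_def)
  note 4 = triple_count_loop[of "concat bs" n c \<tau> k l x "n # [0..<n] @ [c]" c]
  have 5: "triple (\<lambda>s. ?R s \<and> outp s = (n # [0..<n] @ [c]) @ [0..<c]) 3 (seqs [Write 3, Add 6 3 9])
      (\<lambda>s. ?R s \<and> outp s = n # [0..<n] @ c # [0..<c] @ [\<tau>] \<and> regs s 6 = length bs)"
    by (rule triple_straight) (auto simp: ready_def assms)
  note 6 = triple_write_profiles[OF assms(1), of c \<tau> k l x "n # [0..<n] @ c # [0..<c] @ [\<tau>]"]
  have 7: "triple (\<lambda>s. ready [] n c \<tau> k l x s \<and>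
        outp s = (n # [0..<n] @ c # [0..<c] @ [\<tau>]) @ concat (map ((#) n) bs)) 4
      (seqs [Write 12, Write 13, Write 14])
      (\<lambda>s. outp s = n # [0..<n] @ c # [0..<c] @ \<tau> # concat (map ((#) n) bs) @ [k, l, x])"
    by (rule triple_straight) (auto simp: ready_def)
  show ?thesis
    unfolding write_instance_def
    by (rule triple_conseq[OF triple_Seq[OF 1 triple_Seq[OF 2 triple_Seq[OF 3 triple_Seq[OF 4
      triple_Seq[OF 5 triple_Seq[OF 6 7]]]]]]]) (auto simp: assms)
qed

definition min_prog :: "nat \<Rightarrow> nat \<Rightarrow> ram" where
  "min_prog r a = Seq (Sub 16 r a) (Sub r r 16)"

lemma wp_min_prog [simp]:
  "r \<noteq> 16 \<Longrightarrow> wp (min_prog r a) R s \<longleftrightarrow>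
    R (s\<lparr>regs := (regs s)(16 := regs s r - regs s a, r := min (regs s r) (regs s a))\<rparr>)"
  by (simp add: min_prog_def min_def)

lemma len_min_prog [simp]: "len (min_prog r a) = 2"
  by (simp add: min_prog_def)

definition calm_prog :: ram where
  "calm_prog = seqs [Add 15 4 9, Add 17 4 0, min_prog 12 17, min_prog 13 4, Add 17 1 0, min_prog 14 17]"

lemma triple_calm_prog:
  "triple (before ws n c \<tau> m k l x) 10 calm_prog
    (\<lambda>s. ready ws n m \<tau> (min k (Suc m)) (min l m) (min x (Suc n)) s \<and> outp s = [])"
  by (rule triple_straight)
    (auto simp: calm_prog_def before_def ready_def)

definition slack_step :: ram where
  "slack_step = seqs [Sub 12 12 0, Sub 13 13 0, Sub 13 13 0, Sub 15 15 0, Sub 15 15 0,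
     Sub 18 18 0, Sub 18 18 0, Sub 19 18 0]"

definition lively_prog :: ram where
  "lively_prog =
    Seq (seqs [Sub 15 2 4, Add 17 4 0, Sub 18 12 17, Add 18 18 18, min_prog 18 15, min_prog 18 13,
      Sub 19 18 0]) (Seq (WhileNZ 19 slack_step)
    (seqs [Add 17 4 4, Add 17 17 4, Add 17 17 0, Add 17 17 0, Add 17 17 0, min_prog 13 17,
      Add 17 13 13, min_prog 15 17, Add 15 15 4, Add 17 15 0, min_prog 12 17,
      Add 17 1 0, min_prog 14 17]))"

lemma triple_lively_prog:
  fixes c m k l d :: nat
  defines "d \<equiv> c - m"
  shows "triple (before ws n c \<tau> m k l x) (10 * c + 50) lively_prog
    (\<lambda>s. ready ws n (m + lively_dummies m k l d) \<tau> (lively_size m k l d) (lively_change m k l d)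
      (min x (Suc n)) s \<and> outp s = [])"
proof -
  define e where "e = min (min (2 * (k - Suc m)) d) l"
  define Q where "Q = (\<lambda>s :: ram_state. regs s 0 = 1 \<and> regs s 9 = 0 \<and> regs s 1 = n \<and> regs s 3 = \<tau> \<and> regs s 4 = m \<and>
    regs s 14 = x \<and> stored ws (regs s 5) (mem s) \<and> outp s = [])"
  define Inv where "Inv = (\<lambda>(done :: unit list) (zs :: unit list) s. Q s \<and>
    length done + length zs = e div 2 \<and> regs s 12 = k - length done \<and>
    regs s 13 = l - 2 * length done \<and> regs s 15 = d - 2 * length done \<and>
    regs s 18 = e - 2 * length done \<and> regs s 19 = e - 2 * length done - 1)"
  let ?zs = "replicate (e div 2) ()"
  have start: "triple (before ws n c \<tau> m k l x) 12
      (seqs [Sub 15 2 4, Add 17 4 0, Sub 18 12 17, Add 18 18 18, min_prog 18 15, min_prog 18 13,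
        Sub 19 18 0]) (Inv [] ?zs)"
    by (rule triple_straight)
      (auto simp: before_def Inv_def Q_def d_def e_def mult_2)
  have "triple (Inv done (z # zs)) 9 slack_step (Inv (done @ [z]) zs)" for "done" z zs
    by (rule triple_straight) (auto simp: slack_step_def Inv_def Q_def)
  moreover have "regs s 19 = 0 \<longleftrightarrow> zs = []" if "Inv done zs s" for "done" zs s
  proof -
    have "regs s 19 = 0 \<longleftrightarrow> length zs = 0" using that unfolding Inv_def by linarith
    then show ?thesis by simp
  qed
  ultimately have loop: "triple (Inv [] ?zs) (10 * (e div 2) + 1) (WhileNZ 19 slack_step) (Inv ?zs [])"
    using triple_WhileNZ_list[of Inv 9 slack_step 19 "[]" ?zs] by simp
  have slack: "slack m k l d = e div 2" by (simp add: slack_def e_def)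
  have stop: "triple (Inv ?zs []) 30
      (seqs [Add 17 4 4, Add 17 17 4, Add 17 17 0, Add 17 17 0, Add 17 17 0, min_prog 13 17,
        Add 17 13 13, min_prog 15 17, Add 15 15 4, Add 17 15 0, min_prog 12 17,
        Add 17 1 0, min_prog 14 17])
      (\<lambda>s. ready ws n (m + lively_dummies m k l d) \<tau> (lively_size m k l d) (lively_change m k l d)
        (min x (Suc n)) s \<and> outp s = [])"
  proof (rule triple_straight, goal_cases)
    case (1 s)
    let ?L = "lively_change m k l d" and ?D = "lively_dummies m k l d"
    have L: "min (l - 2 * (e div 2)) (m + m + m + 1 + 1 + 1) = ?L"
      unfolding lively_change_def slack by (rule arg_cong2[where f = min]) auto
    have D: "min (d - 2 * (e div 2)) (?L + ?L) = ?D"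
      unfolding lively_dummies_def slack mult_2[of ?L] ..
    have K: "min (k - e div 2) (?D + m + 1) = lively_size m k l d"
      unfolding lively_size_def slack by (simp add: add.commute)
    show ?case
      using 1
      by (simp del: One_nat_def add_Suc_right add_Suc
        add: Inv_def Q_def ready_def L D K)
  qed simp
  have "e div 2 \<le> c" unfolding e_def d_def by linarith
  then show ?thesis
    unfolding lively_prog_def
    by (intro triple_conseq[OF triple_Seq[OF start triple_Seq[OF loop stop]]]) auto
qed

section \<open>Running time and size of the kernel\<close>

lemma nbits_pos: "1 \<le> nbits x"
  by (simp add: nbits_def)

lemma length_le_word_size: "length xs \<le> word_size xs"
proof (induction xs)
  case (Cons x xs)
  then show ?case using nbits_pos[of x] by (simp add: word_size_def)
qed (simp add: word_size_def)

lemma nbits_le_word_size: "x \<in> set xs \<Longrightarrow> nbits x \<le> word_size xs"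
  unfolding word_size_def by (simp add: member_le_sum_list)

lemma nbits_le_Suc: "nbits x \<le> Suc x"
proof -
  have "x < 2 ^ Suc x" by (induction x) auto
  then show ?thesis by (simp add: nbits_le_iff)
qed

lemma word_size_le:
  assumes "\<And>x. x \<in> set xs \<Longrightarrow> x \<le> M"
  shows "word_size xs \<le> length xs * Suc M"
  using assms
proof (induction xs)
  case (Cons x xs)
  then have "word_size xs \<le> length xs * Suc M" "x \<le> M" by auto
  then show ?case using nbits_le_Suc[of x] by (simp add: word_size_def)
qed (simp add: word_size_def)

lemma enc_mpv_eq:
  "enc_mpv I = num_agents I # sorted_list_of_set (agents I) @
    card (candidates I) # sorted_list_of_set (candidates I) @
    num_profiles I # concat (map ((#) (num_agents I)) (map (vote_codes I) (profiles I))) @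
    [com_size I, change I, min_score I]"
proof -
  have "enc_profile (agents I) = (#) (num_agents I) \<circ> vote_codes I"
    by (simp add: fun_eq_iff enc_profile_def vote_codes_def num_agents_def)
  then show ?thesis by (simp add: enc_mpv_def enc_set_def num_agents_def)
qed

lemma reduced_simps:
  "agents (reduced I c k l) = {..<num_agents I}" "candidates (reduced I c k l) = {..<c}"
  "profiles (reduced I c k l) = map (renamed_profile I) (profiles I)"
  "com_size (reduced I c k l) = k" "change (reduced I c k l) = l"
  "min_score (reduced I c k l) = min (min_score I) (Suc (num_agents I))"
  "num_agents (reduced I c k l) = num_agents I" "num_profiles (reduced I c k l) = num_profiles I"
  by (simp_all add: reduced_def num_agents_def num_profiles_def)

lemma enc_reduced:
  "enc_mpv (reduced I c k l) = num_agents I # [0..<num_agents I] @ c # [0..<c] @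
    num_profiles I #
    concat (map ((#) (num_agents I)) (map (map (number (vote_stream I)) \<circ> vote_codes I) (profiles I))) @
    [k, l, min (min_score I) (Suc (num_agents I))]"
proof -
  have lessThan: "sorted_list_of_set {..<j} = [0..<j]" for j :: nat
    by (simp add: lessThan_atLeast0)
  have "vote_codes (reduced I c k l) (renamed_profile I u) = map (number (vote_stream I)) (vote_codes I u)"
    for u
  proof (rule nth_equalityI)
    fix i assume "i < length (vote_codes (reduced I c k l) (renamed_profile I u))"
    then have i: "i < num_agents I" by (simp add: reduced_simps)
    have "vote_codes (reduced I c k l) (renamed_profile I u) ! i = enc_vote (renamed_profile I u i)"
      using i by (simp add: vote_codes_def reduced_simps lessThan)
    then show "vote_codes (reduced I c k l) (renamed_profile I u) ! i =
        map (number (vote_stream I)) (vote_codes I u) ! i"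
      using i by (simp add: renamed_profile_def)
  qed (simp add: reduced_simps)
  then show ?thesis
    unfolding enc_mpv_eq[of "reduced I c k l"] by (simp add: reduced_simps lessThan o_def)
qed

lemma poly_time_on_reduced:
  fixes mid :: ram and c k l :: "(nat, nat) mpv \<Rightarrow> nat"
  assumes bits: "const_bits mid \<le> 1"
    and mid: "\<And>I ws. valid_mpv I \<Longrightarrow>
      triple (before ws (num_agents I) (card (candidates I)) (num_profiles I) (num_voted I)
          (com_size I) (change I) (min_score I))
        (10 * card (candidates I) + 50) mid
        (\<lambda>s. ready ws (num_agents I) (c I) (num_profiles I) (k I) (l I)
          (min (min_score I) (Suc (num_agents I))) s \<and> outp s = [])"
    and c: "\<And>I. valid_mpv I \<Longrightarrow> c I \<le> card (candidates I)"
  shows "poly_time_on valid_mpv enc_mpv (\<lambda>I. reduced I (c I) (k I) (l I))"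
proof -
  let ?P = "Seq read_instance (Seq mid write_instance)"
  define p :: "nat poly" where "p = [:110, 50, 28:]"
  have "\<exists>t s. exec ?P (init_state (enc_mpv I)) t s \<and> outp s = enc_mpv (reduced I (c I) (k I) (l I)) \<and>
      t \<le> poly (smult 2 (p * ([:0, 1:] + p))) (word_size (enc_mpv I))"
    if I: "valid_mpv I" for I
  proof -
    let ?n = "num_agents I" and ?c = "card (candidates I)" and ?\<tau> = "num_profiles I"
    let ?W = "word_size (enc_mpv I)" and ?ws = "map (number (vote_stream I)) (vote_stream I)"
    let ?bs = "map (vote_codes I) (profiles I)"
    let ?bs' = "map (map (number (vote_stream I)) \<circ> vote_codes I) (profiles I)"
    let ?cost = "((21 * ?n + 11) * ?\<tau> + 4 * ?n + 4 * ?c + 30) +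
      ((10 * ?c + 50) + ((7 * ?n + 11) * ?\<tau> + 5 * ?n + 5 * c I + 30))"
    have bs: "concat ?bs = vote_stream I" by (simp add: vote_stream_def)
    have "triple (\<lambda>s. s = init_state (enc_mpv I)) ((21 * ?n + 11) * ?\<tau> + 4 * ?n + 4 * ?c + 30)
        read_instance (before ?ws ?n ?c ?\<tau> (num_voted I) (com_size I) (change I) (min_score I))"
      unfolding enc_mpv_eq num_voted_def bs[symmetric]
      by (rule triple_read_instance) (simp_all add: num_agents_def num_profiles_def)
    moreover have "concat ?bs' = ?ws" by (simp add: vote_stream_def map_concat o_def)
    then have "triple (\<lambda>s. ready ?ws ?n (c I) ?\<tau> (k I) (l I) (min (min_score I) (Suc ?n)) s \<and> outp s = [])
        ((7 * ?n + 11) * ?\<tau> + 5 * ?n + 5 * c I + 30) write_instance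
        (\<lambda>s. outp s = enc_mpv (reduced I (c I) (k I) (l I)))"
      using triple_write_instance[of ?bs' ?n ?\<tau> "c I" "k I" "l I" "min (min_score I) (Suc ?n)"]
      unfolding enc_reduced by (simp add: num_profiles_def)
    ultimately have "triple (\<lambda>s. s = init_state (enc_mpv I)) ?cost ?P
        (\<lambda>s. outp s = enc_mpv (reduced I (c I) (k I) (l I)))"
      using mid[OF I] by (intro triple_Seq)
    then obtain t s where run: "exec ?P (init_state (enc_mpv I)) t s"
      "outp s = enc_mpv (reduced I (c I) (k I) (l I))"
      and time: "\<And>B. const_bits ?P \<le> B \<Longrightarrow> fits B (init_state (enc_mpv I)) \<Longrightarrow> t \<le> 2 * ?cost * (B + ?cost)"
      unfolding triple_def by metis
    have le: "?n + ?c + ?\<tau> + 1 \<le> ?W"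
    proof -
      have "?n + ?c + ?\<tau> + 1 \<le> length (enc_mpv I)"
        unfolding enc_mpv_eq
        by (simp add: length_concat o_def sum_list_triv num_agents_def num_profiles_def)
      then show ?thesis using length_le_word_size[of "enc_mpv I"] by simp
    qed
    have "const_bits ?P \<le> ?W"
      using bits le by (simp add: read_instance_def skip_loop_def scan_profile_def scan_vote_def
        write_instance_def count_loop_def write_profile_def nbits_def floorlog_def)
    moreover have "fits ?W (init_state (enc_mpv I))"
      using le nbits_le_iff[of ?W] nbits_le_word_size[of _ "enc_mpv I"]
      by (auto simp: fits_def init_state_def)
    ultimately have "t \<le> 2 * ?cost * (?W + ?cost)" by (rule time)
    also have cost: "?cost \<le> poly p ?W"
    proof -
      have "?n * ?\<tau> \<le> ?W * ?W" using le by (intro mult_mono) auto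
      then show ?thesis using le c[OF I] by (simp add: p_def algebra_simps)
    qed
    then have "2 * ?cost * (?W + ?cost) \<le> 2 * poly p ?W * (?W + poly p ?W)"
      by (intro mult_mono add_mono) auto
    finally show ?thesis using run by (auto simp: algebra_simps)
  qed
  then show ?thesis unfolding poly_time_on_def by blast
qed

lemma distinct_count_le: "distinct_count vs \<le> length vs"
  by (induction vs rule: rev_induct) (auto simp: distinct_count_snoc)

lemma number_le: "number vs v \<le> distinct_count vs"
  by (induction vs rule: rev_induct) (auto simp: number_snoc distinct_count_snoc le_SucI)

lemma num_voted_le: "num_voted I \<le> num_profiles I * num_agents I"
proof -
  have "length (vote_stream I) = num_profiles I * num_agents I"
    by (simp add: vote_stream_def length_concat o_def sum_list_triv num_profiles_def)
  then show ?thesis using distinct_count_le[of "vote_stream I"] by (simp add: num_voted_def)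
qed

lemma word_size_reduced:
  assumes "c \<le> 7 * num_voted I + 6" "k \<le> 7 * num_voted I + 7" "l \<le> 3 * num_voted I + 3"
  shows "word_size (enc_mpv (reduced I c k l)) \<le>
    poly ([:12, 2, 8:] * [:8, 1, 7:]) (num_agents I + num_profiles I)"
proof -
  let ?n = "num_agents I" and ?\<tau> = "num_profiles I" and ?m = "num_voted I"
  define s where "s = ?n + ?\<tau>"
  have "?\<tau> * ?n \<le> s * s" unfolding s_def by (intro mult_mono) auto
  then have m: "?m \<le> s * s" using num_voted_le[of I] by linarith
  have "x \<le> 7 + s + 7 * (s * s)" if x: "x \<in> set (enc_mpv (reduced I c k l))" for x
  proof -
    have "x \<in> set (map (number (vote_stream I)) (vote_codes I u)) \<Longrightarrow> x \<le> ?m" for u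
      using number_le by (auto simp: num_voted_def)
    then have "x \<le> ?n \<or> x \<le> c \<or> x \<le> ?\<tau> \<or> x \<le> ?m \<or> x \<le> k \<or> x \<le> l \<or> x \<le> Suc ?n"
      using x unfolding enc_reduced by (auto split: if_splits)
    then show ?thesis using assms m unfolding s_def by linarith
  qed
  then have "word_size (enc_mpv (reduced I c k l)) \<le>
      length (enc_mpv (reduced I c k l)) * Suc (7 + s + 7 * (s * s))"
    by (rule word_size_le)
  also have "\<dots> \<le> (12 + 2 * s + 8 * (s * s)) * Suc (7 + s + 7 * (s * s))"
  proof (rule mult_right_mono)
    have "length (enc_mpv (reduced I c k l)) = ?n + c + ?\<tau> * Suc ?n + 6"
      unfolding enc_reduced
      by (simp add: length_concat o_def sum_list_triv num_profiles_def)
    then show "length (enc_mpv (reduced I c k l)) \<le> 12 + 2 * s + 8 * (s * s)"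
      using assms(1) m \<open>?\<tau> * ?n \<le> s * s\<close> unfolding s_def by simp
  qed simp
  finally show ?thesis unfolding s_def[symmetric] by (simp add: algebra_simps)
qed

lemma admits_poly_kernel_reduced:
  assumes "poly_time_on valid_mpv enc_mpv (\<lambda>I. reduced I (c I) (k I) (l I))"
    and "\<And>I. valid_mpv I \<Longrightarrow> yes (reduced I (c I) (k I) (l I)) \<longleftrightarrow> yes I"
    and "\<And>I. valid_mpv I \<Longrightarrow> num_voted I \<le> c I \<and> 1 \<le> k I"
    and "\<And>I. valid_mpv I \<Longrightarrow> c I \<le> 7 * num_voted I + 6 \<and> k I \<le> 7 * num_voted I + 7 \<and>
      l I \<le> 3 * num_voted I + 3"
  shows "admits_poly_kernel valid_mpv yes enc_mpv (\<lambda>I. num_agents I + num_profiles I)"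
  unfolding admits_poly_kernel_def problem_kernel_def
  using assms(1,2) valid_reduced assms(3) word_size_reduced assms(4)
  by (intro exI[of _ "[:12, 2, 8:] * [:8, 1, 7:]"] exI[of _ "\<lambda>I. reduced I (c I) (k I) (l I)"]) blast

lemma num_voted_le_card: "valid_mpv I \<Longrightarrow> num_voted I \<le> card (candidates I)"
  using card_mono[OF finite_candidates voted_subset] card_voted by metis

theorem theorem32:
  shows "admits_poly_kernel (valid_mpv :: (nat, nat) mpv \<Rightarrow> bool) CMPV enc_mpv
           (\<lambda>I. num_agents I + num_profiles I) \<and>
         admits_poly_kernel (valid_mpv :: (nat, nat) mpv \<Rightarrow> bool) RMPV enc_mpv
           (\<lambda>I. num_agents I + num_profiles I)"
proof
  have size: "1 \<le> com_size I" if "valid_mpv I" for I :: "(nat, nat) mpv"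
    using that by (simp add: valid_mpv_def)
  show "admits_poly_kernel (valid_mpv :: (nat, nat) mpv \<Rightarrow> bool) CMPV enc_mpv
      (\<lambda>I. num_agents I + num_profiles I)"
  proof (rule admits_poly_kernel_reduced)
    show "poly_time_on valid_mpv enc_mpv (\<lambda>I. reduced I (num_voted I)
        (min (com_size I) (Suc (num_voted I))) (min (change I) (num_voted I)))"
    proof (rule poly_time_on_reduced[of calm_prog])
      show "const_bits calm_prog \<le> 1" by (simp add: calm_prog_def min_prog_def)
    qed (auto intro: triple_conseq[OF triple_calm_prog] num_voted_le_card)
  qed (use size in \<open>auto simp: CMPV_reduced\<close>)
  let ?d = "\<lambda>I :: (nat, nat) mpv. card (candidates I) - num_voted I"
  let ?f = "\<lambda>g I. g (num_voted I) (com_size I) (change I) (?d I)"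
  show "admits_poly_kernel (valid_mpv :: (nat, nat) mpv \<Rightarrow> bool) RMPV enc_mpv
      (\<lambda>I. num_agents I + num_profiles I)"
  proof (rule admits_poly_kernel_reduced)
    show "poly_time_on valid_mpv enc_mpv (\<lambda>I. reduced I (num_voted I + ?f lively_dummies I)
        (?f lively_size I) (?f lively_change I))"
    proof (rule poly_time_on_reduced[of lively_prog])
      fix I :: "(nat, nat) mpv" assume "valid_mpv I"
      then show "num_voted I + ?f lively_dummies I \<le> card (candidates I)"
        using num_voted_le_card lively_dummies_le(2)
        by (metis add_le_cancel_left le_add_diff_inverse)
    next
      show "const_bits lively_prog \<le> 1"
        by (simp add: lively_prog_def slack_step_def min_prog_def)
    qed (rule triple_lively_prog)
  next
    fix I :: "(nat, nat) mpv" assume I: "valid_mpv I"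
    show "RMPV (reduced I (num_voted I + ?f lively_dummies I) (?f lively_size I) (?f lively_change I)) = RMPV I"
      using RMPV_reduced[OF I] .
    show "num_voted I \<le> num_voted I + ?f lively_dummies I \<and> 1 \<le> ?f lively_size I"
      using lively_size_pos[OF size[OF I]] by simp
    show "num_voted I + ?f lively_dummies I \<le> 7 * num_voted I + 6 \<and>
        ?f lively_size I \<le> 7 * num_voted I + 7 \<and> ?f lively_change I \<le> 3 * num_voted I + 3"
      using lively_change_le[of "num_voted I" "com_size I" "change I" "?d I"]
        lively_dummies_le(1)[of "num_voted I" "com_size I" "change I" "?d I"]
        lively_size_le[of "num_voted I" "com_size I" "change I" "?d I"]
      by linarith
  qed
qed

end
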